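(* Let $n\ge1$, $f\in\mathcal S(\mathcal H_n)$, $0<\beta<1$ and $1\le p<2n/\beta$. Then $$\int_{\mathcal H_n\times\mathcal H_n}\frac{|f(w)-f(w')|^p}{d(w,w')^{2n+2+p\beta}}\,dw\,dw'\ \ge\ F_{p,\beta}\int_{\mathcal H_n}|z|^{-p\beta}|f(w)|^p\,dw,$$ $$F_{p,\beta}=\frac{4^n\sqrt\pi\,\Gamma\!\left[\frac{2n+p\beta}4\right]}{\Gamma\!\left[\frac{2n+2+p\beta}4\right]}\int_{\mathbb R^{2n}}\big|1-|x|^{-\lambda}\big|^p\,|x-\eta|^{-2n-p\beta}\,dx,$$ where $\lambda=(2n-p\beta)/p$ and $\eta\in S^{2n-1}$ (the value does not depend on $\eta$).
   Context: The Heisenberg group is $\mathcal H_n=\{w=(z,t):z\in\mathbb C^n,\ t\in\mathbb R\}$ with group law $(z,t)(z',t')=(z+z',\,t+t'+2\,\mathrm{Im}\, z\bar z')$, where $z\bar z'=\sum_j z_j\overline{z_j'}$. Haar measure is normalized as $dw=4^n\,dx\,dy\,dt$, where $z=x+iy$ with $x,y\in\mathbb R^n$ and $dx\,dy\,dt$ is Lebesgue measure. The metric is $d(w,w')=d((w')^{-1}w,\hat 0)$ with $\hat0=(0,0)$ and $d((z,t),\hat0)=\big(|z|^4+t^2\big)^{1/4}$. In the weight, $z$ is the $\mathbb C^n$-component of $w$. $\mathcal S(\mathcal H_n)$ is the Schwartz class on $\mathcal H_n\cong\mathbb R^{2n+1}$. *)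

theory Defs
  imports "HOL-Analysis.Analysis"
begin

text \<open>The Schwartz class on a Euclidean space. Iterated partial derivatives are taken along lists of
  standard basis vectors. Differentiability of all of them (including the function itself, for the
  empty list) amounts to smoothness.\<close>

primrec iter_partial ::
    "'a::euclidean_space list \<Rightarrow> ('a \<Rightarrow> 'b::real_normed_vector) \<Rightarrow> 'a \<Rightarrow> 'b" where
  "iter_partial [] f = f"
| "iter_partial (b # bs) f = (\<lambda>x. frechet_derivative (iter_partial bs f) (at x) b)"

definition schwartz :: "('a::euclidean_space \<Rightarrow> 'b::real_normed_vector) \<Rightarrow> bool" where
  "schwartz f \<longleftrightarrow> (\<forall>bs. set bs \<subseteq> Basis \<longrightarrow>
     (\<forall>x. iter_partial bs f differentiable (at x)) \<and>
     (\<forall>k::nat. \<exists>C::real. \<forall>x. (1 + norm x) ^ k * norm (iter_partial bs f x) \<le> C))"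

text \<open>The Heisenberg group of complex dimension \<open>CARD('n)\<close>; the product norm on this type is the
  Euclidean norm of \<open>\<real>\<close> to the power \<open>2n + 1\<close>, but the group law below is not the additive one.\<close>

type_synonym 'n heis = "(complex, 'n) vec \<times> real"

definition heis_mult :: "'n::finite heis \<Rightarrow> 'n heis \<Rightarrow> 'n heis" where
  "heis_mult w w' = (fst w + fst w',
     snd w + snd w' + 2 * Im (\<Sum>j\<in>UNIV. fst w $ j * cnj (fst w' $ j)))"

definition heis_inv :: "'n::finite heis \<Rightarrow> 'n heis" where
  "heis_inv w = (- fst w, - snd w)"

lemma heis_mult_zero [simp]: "heis_mult 0 w = w" "heis_mult w 0 = w"
  by (simp_all add: heis_mult_def)

lemma heis_mult_inv: "heis_mult (heis_inv w) w = 0" "heis_mult w (heis_inv w) = 0"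
  by (simp_all add: heis_mult_def heis_inv_def zero_prod_def sum_negf)

definition heis_gauge :: "'n::finite heis \<Rightarrow> real" where
  "heis_gauge w = root 4 (norm (fst w) ^ 4 + (snd w)\<^sup>2)"

definition heis_dist :: "'n::finite heis \<Rightarrow> 'n heis \<Rightarrow> real" where
  "heis_dist w w' = heis_gauge (heis_mult (heis_inv w') w)"

definition heis_haar :: "'n::finite heis measure" where
  "heis_haar = scale_measure (4 ^ CARD('n)) lborel"

text \<open>The constant is valued in \<open>[0, \<infinity>]\<close>; the dimension \<open>n\<close> is read off from the type of \<open>\<eta>\<close>, a point
  of \<open>\<real>\<close> to the power \<open>2n\<close>.\<close>

definition hardy_const :: "real \<Rightarrow> real \<Rightarrow> real ^ ('n::finite + 'n) \<Rightarrow> ennreal" where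
  "hardy_const p \<beta> \<eta> =
     (let n = real CARD('n); l = (2 * n - p * \<beta>) / p in
       ennreal (4 ^ CARD('n) * sqrt pi * Gamma ((2 * n + p * \<beta>) / 4)
                  / Gamma ((2 * n + 2 + p * \<beta>) / 4)) *
       (\<integral>\<^sup>+ x. ennreal (\<bar>1 - norm x powr (- l)\<bar> powr p
                  * norm (x - \<eta>) powr (- 2 * n - p * \<beta>)) \<partial>lborel))"

end

theory Submission
  imports Defs "HOL-Probability.Distributions"
begin

text \<open>Write \<open>w = (z, t)\<close>, \<open>N = 2 n\<close>, \<open>\<sigma> = p \<beta>\<close>, \<open>l = (N - \<sigma>) / p\<close> and \<open>q = N + 2 + \<sigma>\<close>. The inequality is a
  ground state estimate: \<open>|z| powr - l\<close> is a virtual ground state of the energy, and comparing \<open>f\<close> with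
  it pointwise already gives the sharp constant.

  The pointwise comparison (\<open>ground_state_inequality\<close>) is a consequence of the convexity of
  \<open>x powr p\<close>. With \<open>t = (|z'| / |z|) powr - l\<close>, \<open>x = |f w|\<close> and \<open>y = |f w'|\<close> it bounds
  \<open>|f w - f w'| powr p\<close> below by a difference of a term in which \<open>f\<close> occurs only at \<open>w\<close> and one in which
  \<open>f\<close> occurs only at \<open>w'\<close>. Each of these can be integrated against \<open>d w w' powr - q\<close> in the other
  variable. Integrating over the centre replaces the Heisenberg kernel by a constant times the
  Euclidean kernel \<open>|z - z'| powr (- N - \<sigma>)\<close>; the constant is the quotient of Gamma functions in the
  theorem. The remaining integral over \<open>z'\<close> of a function of \<open>|z'| / |z|\<close> is, by dilation and rotation,
  \<open>|z| powr - \<sigma>\<close> times a number \<open>radial_integral\<close> that depends neither on \<open>z\<close> nor on the unit vector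
  \<open>\<eta>\<close> (\<open>nn_integral_radial_kernel\<close>). So every term becomes a multiple of the weighted integral of
  \<open>|f| powr p\<close>.

  Two points need care. Near the diagonal the two terms of the difference need not be integrable
  separately. The estimate is therefore made on \<open>|z'| > s |z|\<close> with \<open>s > 1\<close>, which respects all
  the invariances, and \<open>s\<close> tends to \<open>1\<close> at the end; by symmetry the whole energy is at least twice this
  part. Secondly, the term at \<open>w'\<close> leads to a radial integral over a ball around \<open>0\<close> and the term at \<open>w\<close>
  to one over the exterior of a ball. The two are compared through the inversion \<open>r \<mapsto> 1 / r\<close>
  (\<open>radial_integral_inversion\<close>), after which the integrands are \<open>(1 - \<rho>) powr (p - 1)\<close> and
  \<open>(1 - \<rho>) powr (p - 1) * \<rho>\<close> with \<open>\<rho> = r powr - l\<close>. Their difference is \<open>(1 - \<rho>) powr p\<close>, and the same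
  inversion shows that its integral over \<open>r > 1\<close> is half of the integral in the constant.\<close>

section \<open>Isometries preserve Lebesgue measure\<close>

text \<open>The usual proof of uniqueness of Haar measure: for the unit ball \<open>B\<close>, the integral of
  \<open>1\<^sub>A(x) 1\<^sub>B(y - x)\<close> over \<open>x\<close> and \<open>y\<close> is evaluated in both orders, and \<open>- B = B\<close>.\<close>

lemma lborel_unique_translation_invariant:
  fixes M :: "'a::euclidean_space measure"
  assumes sets_M [measurable_cong]: "sets M = sets borel"
    and sf: "sigma_finite_measure M"
    and inv: "\<And>y. distr M borel ((+) y) = M"
    and ball: "emeasure M (ball 0 1) = emeasure lborel (ball (0::'a) 1)"
  shows "M = lborel"
proof (rule measure_eqI)
  fix A assume "A \<in> sets M"
  then have [measurable]: "A \<in> sets borel" by (simp add: sets_M)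
  interpret M: sigma_finite_measure M by (rule sf)
  interpret P: pair_sigma_finite lborel M ..
  let ?B = "ball 0 1 :: 'a set"
  have [measurable]: "?B \<in> sets borel" by simp
  have shift: "(\<integral>\<^sup>+x. g x \<partial>M) = (\<integral>\<^sup>+x. g (y + x) \<partial>M)"
    if [measurable]: "g \<in> borel_measurable borel" for g :: "'a \<Rightarrow> ennreal" and y
    by (subst inv[of y, symmetric]) (simp add: nn_integral_distr)
  have shiftL: "(\<integral>\<^sup>+x. g x \<partial>lborel) = (\<integral>\<^sup>+x. g (y + x) \<partial>lborel)"
    if [measurable]: "g \<in> borel_measurable borel" for g :: "'a \<Rightarrow> ennreal" and y
    by (subst lborel_distr_plus[of y, symmetric]) (simp add: nn_integral_distr)
  have "emeasure M A * emeasure lborel ?B = (\<integral>\<^sup>+x. indicator A x * emeasure lborel ?B \<partial>M)"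
    by (simp add: nn_integral_multc)
  also have "\<dots> = (\<integral>\<^sup>+x. (\<integral>\<^sup>+y. indicator A x * indicator ?B (y - x) \<partial>lborel) \<partial>M)"
  proof (rule nn_integral_cong)
    fix x
    have "(\<integral>\<^sup>+y. indicator ?B (y - x) \<partial>lborel) = emeasure lborel ?B"
      by (subst shiftL[of _ x]) simp_all
    then show "indicator A x * emeasure lborel ?B = (\<integral>\<^sup>+y. indicator A x * indicator ?B (y - x) \<partial>lborel)"
      by (simp add: nn_integral_cmult)
  qed
  also have "\<dots> = (\<integral>\<^sup>+y. (\<integral>\<^sup>+x. indicator A x * indicator ?B (y - x) \<partial>M) \<partial>lborel)"
    by (rule P.Fubini') measurable
  also have "\<dots> = (\<integral>\<^sup>+y. (\<integral>\<^sup>+x. indicator A (y + x) * indicator ?B x \<partial>M) \<partial>lborel)"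
  proof (rule nn_integral_cong)
    fix y
    show "(\<integral>\<^sup>+x. indicator A x * indicator ?B (y - x) \<partial>M) = (\<integral>\<^sup>+x. indicator A (y + x) * indicator ?B x \<partial>M)"
      by (subst shift[of _ y]) (auto intro!: nn_integral_cong simp: indicator_def)
  qed
  also have "\<dots> = (\<integral>\<^sup>+x. (\<integral>\<^sup>+y. indicator A (y + x) * indicator ?B x \<partial>lborel) \<partial>M)"
    by (rule P.Fubini'[symmetric]) measurable
  also have "\<dots> = (\<integral>\<^sup>+x. emeasure lborel A * indicator ?B x \<partial>M)"
  proof (rule nn_integral_cong)
    fix x
    have "(\<integral>\<^sup>+y. indicator A (y + x) \<partial>lborel) = emeasure lborel A"
      using shiftL[of "indicator A" x] by (simp add: add.commute)
    then show "(\<integral>\<^sup>+y. indicator A (y + x) * indicator ?B x \<partial>lborel) = emeasure lborel A * indicator ?B x"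
      by (simp add: nn_integral_multc)
  qed
  also have "\<dots> = emeasure lborel A * emeasure lborel ?B"
    by (simp add: nn_integral_cmult ball)
  finally have "emeasure M A * emeasure lborel ?B = emeasure lborel A * emeasure lborel ?B" .
  moreover have "\<not> unit_ball_vol (real DIM('a)) \<le> 0"
    by (simp add: not_le)
  ultimately show "emeasure M A = emeasure lborel A"
    using emeasure_ball[of 1 "0::'a"] by (auto simp: mult_right_ennreal_cancel)
qed (simp add: sets_M)


text \<open>The image measure is translation invariant because \<open>g\<close> is linear and onto, and it gives the unit
  ball the right mass because \<open>g\<close> is isometric. Working between different spaces allows
  \<open>\<complex>\<close> to the power \<open>n\<close> to be compared with \<open>\<real>\<close> to the power \<open>2 n\<close>.\<close>

lemma lborel_distr_isometry:
  fixes g :: "'a::euclidean_space \<Rightarrow> 'b::euclidean_space"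
  assumes lin: "linear g" and nrm: "\<And>x. norm (g x) = norm x" and surj: "surj g"
    and dim: "DIM('a) = DIM('b)"
  shows "distr lborel borel g = lborel"
proof (rule lborel_unique_translation_invariant)
  have cont: "continuous_on UNIV g"
    using lin linear_continuous_on linear_conv_bounded_linear by blast
  have [measurable]: "g \<in> borel_measurable borel"
    by (rule borel_measurable_continuous_onI[OF cont])
  have ballim: "g -` ball 0 1 = ball 0 1"
    by (auto simp: nrm)
  show "sets (distr lborel borel g) = sets borel" by simp
  have emb: "emeasure (distr lborel borel g) (ball 0 r) < \<infinity>" for r
  proof -
    have "g -` ball 0 r = ball 0 r" by (auto simp: nrm)
    then show ?thesis
      using emeasure_lborel_ball_finite[of "0::'a" r] by (simp add: emeasure_distr)
  qed
  show "sigma_finite_measure (distr lborel borel g)"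
  proof
    show "\<exists>A. countable A \<and> A \<subseteq> sets (distr lborel borel g) \<and> \<Union> A = space (distr lborel borel g) \<and>
        (\<forall>a\<in>A. emeasure (distr lborel borel g) a \<noteq> \<infinity>)"
    proof (intro exI conjI)
      show "countable (range (\<lambda>n::nat. ball (0::'b) (real n)))" by simp
      show "\<Union> (range (\<lambda>n::nat. ball (0::'b) (real n))) = space (distr lborel borel g)"
        using reals_Archimedean2 by auto
    qed (use emb less_top in auto)
  qed
  show "emeasure (distr lborel borel g) (ball 0 1) = emeasure lborel (ball (0::'b) 1)"
    by (simp add: emeasure_distr ballim emeasure_ball dim)
  fix y
  obtain x where x: "y = g x" using surj by (metis surjD)
  have eq: "(+) y \<circ> g = g \<circ> (+) x"
    using lin by (auto simp: x linear_add)
  have "distr (distr lborel borel g) borel ((+) y) = distr lborel borel (g \<circ> (+) x)"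
    by (simp add: distr_distr eq)
  also have "\<dots> = distr (distr lborel borel ((+) x)) borel g"
    by (simp add: distr_distr)
  finally show "distr (distr lborel borel g) borel ((+) y) = distr lborel borel g"
    by (simp only: lborel_distr_plus)
qed

lemma exists_isometry_mapping_unit_vector:
  fixes \<eta> :: "real ^ 'm" and \<xi> :: "'b::euclidean_space"
  assumes dim: "DIM('b) = CARD('m)" and "norm \<eta> = 1" "norm \<xi> = 1"
  obtains g where "linear g" "\<And>x. norm (g x) = norm x" "g \<eta> = \<xi>" "distr lborel borel g = lborel"
proof -
  obtain f :: "real ^ 'm \<Rightarrow> 'b" and h :: "'b \<Rightarrow> real ^ 'm"
    where f: "linear f" "range f = UNIV" "\<And>x. norm (f x) = norm x"
      and h: "linear h" "\<And>x. norm (h x) = norm x" "\<And>x. f (h x) = x"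
  proof (rule isometries_subspaces[OF subspace_UNIV subspace_UNIV])
    show "dim (UNIV :: (real^'m) set) = dim (UNIV :: 'b set)" using dim by simp
  next
    fix f :: "real ^ 'm \<Rightarrow> 'b" and h :: "'b \<Rightarrow> real ^ 'm"
    assume "linear f" "linear h" "range f = UNIV" "\<And>x. x \<in> UNIV \<Longrightarrow> norm (f x) = norm x"
      "\<And>x. x \<in> UNIV \<Longrightarrow> norm (h x) = norm x" "\<And>x. x \<in> UNIV \<Longrightarrow> f (h x) = x"
    then show thesis by (intro that[of f h]) auto
  qed
  obtain T where T: "orthogonal_transformation T" "T \<eta> = h \<xi>"
    using orthogonal_transformation_exists[of \<eta> "h \<xi>"] assms h by auto
  have lin: "linear (f \<circ> T)"
    using f T by (simp add: linear_compose orthogonal_transformation_linear)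
  have nrm: "norm ((f \<circ> T) x) = norm x" for x
    using f T by (simp add: orthogonal_transformation_norm)
  have "surj (f \<circ> T)"
    by (rule comp_surj[OF orthogonal_transformation_surj[OF T(1)] f(2)])
  then have "distr lborel borel (f \<circ> T) = lborel"
    by (intro lborel_distr_isometry lin nrm) (simp_all add: dim)
  moreover have "(f \<circ> T) \<eta> = \<xi>" by (simp add: T h)
  ultimately show thesis using that lin nrm by blast
qed

lemma nn_integral_lborel_scaleR:
  fixes f :: "'a::euclidean_space \<Rightarrow> ennreal"
  assumes [measurable]: "f \<in> borel_measurable borel" and "0 < c"
  shows "(\<integral>\<^sup>+x. f x \<partial>lborel) = ennreal (c ^ DIM('a)) * (\<integral>\<^sup>+x. f (c *\<^sub>R x) \<partial>lborel)"
  using \<open>0 < c\<close> by (subst lborel_affine[of c 0])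
    (simp_all add: nn_integral_density nn_integral_distr nn_integral_cmult)

section \<open>Radial functions against a homogeneous kernel\<close>

text \<open>The exponent makes the kernel homogeneous of degree \<open>- N - \<sigma>\<close> in dimension \<open>N\<close>, as for the
  fractional Sobolev energy. The value does not depend on the unit vector \<open>\<eta>\<close>.\<close>

definition radial_integral :: "real \<Rightarrow> (real \<Rightarrow> ennreal) \<Rightarrow> 'a::euclidean_space \<Rightarrow> ennreal" where
  "radial_integral \<sigma> \<Psi> \<eta> =
     (\<integral>\<^sup>+u. \<Psi> (norm u) * ennreal (norm (u - \<eta>) powr (- real DIM('a) - \<sigma>)) \<partial>lborel)"

text \<open>Substitute \<open>y = |x| g u\<close> with a linear isometry \<open>g\<close> that takes \<open>\<eta>\<close> to the direction of \<open>x\<close>: the Jacobian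
  \<open>|x| ^ N\<close> and the kernel together leave the factor \<open>|x| powr - \<sigma>\<close>.\<close>

lemma nn_integral_radial_kernel:
  fixes \<eta> :: "real ^ 'm" and x :: "'b::euclidean_space"
  assumes dim: "DIM('b) = CARD('m)" and \<eta>: "norm \<eta> = 1" and x: "x \<noteq> 0"
    and [measurable]: "\<Psi> \<in> borel_measurable borel"
  shows "(\<integral>\<^sup>+y. \<Psi> (norm y / norm x) * ennreal (norm (x - y) powr (- real DIM('b) - \<sigma>)) \<partial>lborel)
    = ennreal (norm x powr - \<sigma>) * radial_integral \<sigma> \<Psi> \<eta>"
proof -
  let ?r = "norm x" and ?q = "- real DIM('b) - \<sigma>"
  have r: "?r > 0" using x by simp
  obtain g :: "real ^ 'm \<Rightarrow> 'b" where g: "linear g" "\<And>x. norm (g x) = norm x" "g \<eta> = x /\<^sub>R norm x"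
      and d: "distr lborel borel g = lborel"
    using exists_isometry_mapping_unit_vector[OF dim \<eta>, of "x /\<^sub>R norm x"] x by auto
  have [measurable]: "g \<in> borel_measurable borel"
    by (intro borel_measurable_continuous_onI linear_continuous_on)
      (use g(1) linear_conv_bounded_linear in blast)
  have "(\<integral>\<^sup>+y. \<Psi> (norm y / ?r) * ennreal (norm (x - y) powr ?q) \<partial>lborel)
      = ennreal (?r ^ DIM('b)) * (\<integral>\<^sup>+y. \<Psi> (norm y) * ennreal (norm (x - ?r *\<^sub>R y) powr ?q) \<partial>lborel)"
    using r by (subst nn_integral_lborel_scaleR[OF _ r]) simp_all
  also have "(\<integral>\<^sup>+y. \<Psi> (norm y) * ennreal (norm (x - ?r *\<^sub>R y) powr ?q) \<partial>lborel)
      = (\<integral>\<^sup>+u. \<Psi> (norm u) * ennreal (norm (x - ?r *\<^sub>R g u) powr ?q) \<partial>lborel)"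
    by (subst d[symmetric]) (simp add: nn_integral_distr g)
  also have "\<dots> = (\<integral>\<^sup>+u. ennreal (?r powr ?q) * (\<Psi> (norm u) * ennreal (norm (u - \<eta>) powr ?q)) \<partial>lborel)"
  proof (rule nn_integral_cong)
    fix u
    have "x - ?r *\<^sub>R g u = ?r *\<^sub>R g (\<eta> - u)"
      using x by (simp add: linear_diff[OF g(1)] g(3) algebra_simps)
    then have "norm (x - ?r *\<^sub>R g u) = ?r * norm (u - \<eta>)"
      by (simp add: g(2) norm_minus_commute)
    then show "\<Psi> (norm u) * ennreal (norm (x - ?r *\<^sub>R g u) powr ?q)
        = ennreal (?r powr ?q) * (\<Psi> (norm u) * ennreal (norm (u - \<eta>) powr ?q))"
      by (simp add: powr_mult ennreal_mult mult_ac)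
  qed
  also have "\<dots> = ennreal (?r powr ?q) * radial_integral \<sigma> \<Psi> \<eta>"
    by (simp add: nn_integral_cmult radial_integral_def dim)
  also have "ennreal (?r ^ DIM('b)) * (ennreal (?r powr ?q) * radial_integral \<sigma> \<Psi> \<eta>)
      = ennreal (?r powr - \<sigma>) * radial_integral \<sigma> \<Psi> \<eta>"
  proof -
    have "?r ^ DIM('b) * ?r powr ?q = ?r powr - \<sigma>"
      using r by (simp add: powr_realpow[symmetric] powr_add[symmetric] del: powr_realpow)
    then show ?thesis
      by (simp add: mult.assoc[symmetric] ennreal_mult[symmetric])
  qed
  finally show ?thesis .
qed

text \<open>This is the effect of the Kelvin transform \<open>u \<mapsto> u / |u|\<^sup>2\<close> on radial functions, obtained without
  a change of variables. Evaluate the integral of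
  \<open>\<phi>(|x|) |x| powr (\<sigma> - N) \<Psi>(|y| / |x|) |x - y| powr (- N - \<sigma>)\<close> over \<open>x\<close> and \<open>y\<close> in both orders. Integrating
  first over \<open>y\<close> gives the left-hand side times \<open>\<Phi>\<close>, the integral of \<open>\<phi>(|x|) |x| powr - N\<close>;
  integrating first over \<open>x\<close> exchanges the roles of the two radii and gives the right-hand side times
  \<open>\<Phi>\<close>. Any cut-off \<open>\<phi>\<close> with \<open>0 < \<Phi> < \<infinity>\<close> will do.\<close>

lemma radial_integral_inversion:
  fixes \<eta> :: "real ^ 'm"
  assumes \<eta>: "norm \<eta> = 1" and [measurable]: "\<Psi> \<in> borel_measurable borel"
  shows "radial_integral \<sigma> \<Psi> \<eta>
    = radial_integral \<sigma> (\<lambda>r. \<Psi> (1 / r) * ennreal (r powr (\<sigma> - real CARD('m)))) \<eta>"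
proof -
  let ?N = "real CARD('m)"
  let ?\<phi> = "\<lambda>r::real. indicator {1<..<2} r :: ennreal"
  let ?k = "\<lambda>x y :: real ^ 'm. ennreal (norm (x - y) powr (- ?N - \<sigma>))"
  let ?\<Psi> = "\<lambda>r. \<Psi> (1 / r) * ennreal (r powr (\<sigma> - ?N))"
  define \<Phi> where "\<Phi> = (\<integral>\<^sup>+x. ?\<phi> (norm x) * ennreal (norm (x :: real ^ 'm) powr - ?N) \<partial>lborel)"
  \<comment> \<open>The measure with density \<open>|x| powr - N\<close> is invariant under dilations.\<close>
  have dil: "(\<integral>\<^sup>+y. ?\<phi> (c * norm y) * ennreal (norm (y :: real ^ 'm) powr - ?N) \<partial>lborel) = \<Phi>"
    if c: "c > 0" for c
  proof -
    have "\<Phi> = ennreal (c ^ CARD('m)) *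
        (\<integral>\<^sup>+y. ennreal (c powr - ?N) * (?\<phi> (c * norm y) * ennreal (norm (y :: real ^ 'm) powr - ?N)) \<partial>lborel)"
      unfolding \<Phi>_def using c
      by (subst nn_integral_lborel_scaleR[OF _ c]) (simp_all add: powr_mult ennreal_mult mult_ac)
    also have "\<dots> = ennreal (c ^ CARD('m)) * (ennreal (c powr - ?N) *
        (\<integral>\<^sup>+y. ?\<phi> (c * norm y) * ennreal (norm (y :: real ^ 'm) powr - ?N) \<partial>lborel))"
      by (subst nn_integral_cmult) simp_all
    also have "\<dots> = ennreal (c ^ CARD('m) * c powr - ?N) *
        (\<integral>\<^sup>+y. ?\<phi> (c * norm y) * ennreal (norm (y :: real ^ 'm) powr - ?N) \<partial>lborel)"
      using c by (simp add: ennreal_mult mult.assoc)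
    also have "c ^ CARD('m) * c powr - ?N = 1"
      using c by (simp add: powr_minus powr_realpow)
    finally show ?thesis by simp
  qed
  have rearrange: "a * (f * b * h * e) = f * c * (h * d * e)" if "a * b = c * d"
    for a b c d e f h :: ennreal
  proof -
    have "a * (f * b * h * e) = (a * b) * (f * h * e)" by (simp add: mult_ac)
    also have "\<dots> = f * c * (h * d * e)" unfolding that by (simp add: mult_ac)
    finally show ?thesis .
  qed
  have "radial_integral \<sigma> \<Psi> \<eta> * \<Phi>
      = (\<integral>\<^sup>+x. ?\<phi> (norm x) * ennreal (norm (x :: real ^ 'm) powr - ?N) * radial_integral \<sigma> \<Psi> \<eta> \<partial>lborel)"
    unfolding \<Phi>_def by (subst nn_integral_multc) (simp_all add: mult.commute)
  also have "\<dots> = (\<integral>\<^sup>+x. (\<integral>\<^sup>+y. ?\<phi> (norm x) * ennreal (norm x powr (\<sigma> - ?N)) *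
        (\<Psi> (norm y / norm x) * ?k x y) \<partial>lborel) \<partial>lborel)"
  proof (rule nn_integral_cong)
    fix x :: "real ^ 'm"
    show "?\<phi> (norm x) * ennreal (norm x powr - ?N) * radial_integral \<sigma> \<Psi> \<eta>
      = (\<integral>\<^sup>+y. ?\<phi> (norm x) * ennreal (norm x powr (\<sigma> - ?N)) * (\<Psi> (norm y / norm x) * ?k x y) \<partial>lborel)"
    proof (cases "x = 0")
      case False
      have "(\<integral>\<^sup>+y. ?\<phi> (norm x) * ennreal (norm x powr (\<sigma> - ?N)) * (\<Psi> (norm y / norm x) * ?k x y) \<partial>lborel)
        = ?\<phi> (norm x) * ennreal (norm x powr (\<sigma> - ?N)) * (ennreal (norm x powr - \<sigma>) * radial_integral \<sigma> \<Psi> \<eta>)"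
        using nn_integral_radial_kernel[OF _ \<eta> False, of \<Psi> \<sigma>] by (subst nn_integral_cmult) simp_all
      also have "\<dots> = ?\<phi> (norm x) * ennreal (norm x powr (\<sigma> - ?N) * norm x powr - \<sigma>) * radial_integral \<sigma> \<Psi> \<eta>"
        by (simp add: ennreal_mult mult.assoc)
      also have "norm x powr (\<sigma> - ?N) * norm x powr - \<sigma> = norm x powr - ?N"
        by (simp add: powr_add[symmetric])
      finally show ?thesis by simp
    qed simp
  qed
  also have "\<dots> = (\<integral>\<^sup>+y. (\<integral>\<^sup>+x. ?\<phi> (norm x) * ennreal (norm x powr (\<sigma> - ?N)) *
        (\<Psi> (norm y / norm x) * ?k x y) \<partial>lborel) \<partial>lborel)"
    by (rule lborel_pair.Fubini') measurable
  also have "\<dots> = (\<integral>\<^sup>+y. (\<integral>\<^sup>+u. ?\<phi> (norm u * norm y) * ennreal (norm (y :: real ^ 'm) powr - ?N) *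
        (?\<Psi> (norm u) * ennreal (norm (u - \<eta>) powr (- ?N - \<sigma>))) \<partial>lborel) \<partial>lborel)"
  proof (rule nn_integral_cong_AE, rule AE_mp[OF AE_lborel_singleton[of 0]], rule AE_I2, rule impI)
    fix y :: "real ^ 'm" assume y: "y \<noteq> 0"
    define \<Theta> where "\<Theta> = (\<lambda>r. ?\<phi> (r * norm y) * ennreal ((r * norm y) powr (\<sigma> - ?N)) * \<Psi> (1 / r))"
    have [measurable]: "\<Theta> \<in> borel_measurable borel" unfolding \<Theta>_def by measurable
    have "(\<integral>\<^sup>+x. ?\<phi> (norm x) * ennreal (norm x powr (\<sigma> - ?N)) * (\<Psi> (norm y / norm x) * ?k x y) \<partial>lborel)
        = (\<integral>\<^sup>+x. \<Theta> (norm x / norm y) * ?k y x \<partial>lborel)"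
      using y by (intro nn_integral_cong) (simp add: \<Theta>_def mult_ac norm_minus_commute)
    also have "\<dots> = ennreal (norm y powr - \<sigma>) * radial_integral \<sigma> \<Theta> \<eta>"
      using nn_integral_radial_kernel[OF _ \<eta> y, of \<Theta> \<sigma>] by simp
    also have "\<dots> = (\<integral>\<^sup>+u. ennreal (norm y powr - \<sigma>) * (\<Theta> (norm u) * ennreal (norm (u - \<eta>) powr (- ?N - \<sigma>))) \<partial>lborel)"
      unfolding radial_integral_def by (subst nn_integral_cmult) simp_all
    also have "\<dots> = (\<integral>\<^sup>+u. ?\<phi> (norm u * norm y) * ennreal (norm y powr - ?N) *
        (?\<Psi> (norm u) * ennreal (norm (u - \<eta>) powr (- ?N - \<sigma>))) \<partial>lborel)"
    proof (rule nn_integral_cong)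
      fix u :: "real ^ 'm"
      have "ennreal (norm y powr - \<sigma>) * ennreal ((norm u * norm y) powr (\<sigma> - ?N))
          = ennreal (norm y powr - ?N) * ennreal (norm u powr (\<sigma> - ?N))"
        using y by (simp add: powr_mult ennreal_mult[symmetric] mult_ac)
          (simp add: powr_add[symmetric])
      then show "ennreal (norm y powr - \<sigma>) * (\<Theta> (norm u) * ennreal (norm (u - \<eta>) powr (- ?N - \<sigma>)))
          = ?\<phi> (norm u * norm y) * ennreal (norm y powr - ?N) *
            (?\<Psi> (norm u) * ennreal (norm (u - \<eta>) powr (- ?N - \<sigma>)))"
        unfolding \<Theta>_def by (rule rearrange)
    qed
    finally show "(\<integral>\<^sup>+x. ?\<phi> (norm x) * ennreal (norm x powr (\<sigma> - ?N)) * (\<Psi> (norm y / norm x) * ?k x y) \<partial>lborel)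
        = (\<integral>\<^sup>+u. ?\<phi> (norm u * norm y) * ennreal (norm y powr - ?N) *
        (?\<Psi> (norm u) * ennreal (norm (u - \<eta>) powr (- ?N - \<sigma>))) \<partial>lborel)" .
  qed
  also have "\<dots> = (\<integral>\<^sup>+u. (\<integral>\<^sup>+y. ?\<phi> (norm u * norm y) * ennreal (norm y powr - ?N) *
        (?\<Psi> (norm u) * ennreal (norm (u - \<eta>) powr (- ?N - \<sigma>))) \<partial>(lborel :: (real ^ 'm) measure)) \<partial>lborel)"
    by (rule lborel_pair.Fubini') measurable
  also have "\<dots> = (\<integral>\<^sup>+u. \<Phi> * (?\<Psi> (norm u) * ennreal (norm (u - \<eta>) powr (- ?N - \<sigma>))) \<partial>lborel)"
  proof (rule nn_integral_cong_AE, rule AE_mp[OF AE_lborel_singleton[of 0]], rule AE_I2, rule impI)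
    fix u :: "real ^ 'm" assume "u \<noteq> 0"
    then show "(\<integral>\<^sup>+y. ?\<phi> (norm u * norm y) * ennreal (norm y powr - ?N) *
        (?\<Psi> (norm u) * ennreal (norm (u - \<eta>) powr (- ?N - \<sigma>))) \<partial>(lborel :: (real ^ 'm) measure))
      = \<Phi> * (?\<Psi> (norm u) * ennreal (norm (u - \<eta>) powr (- ?N - \<sigma>)))"
      by (subst nn_integral_multc) (simp_all add: dil)
  qed
  also have "\<dots> = radial_integral \<sigma> ?\<Psi> \<eta> * \<Phi>"
    unfolding radial_integral_def by (subst nn_integral_cmult) (simp_all add: mult.commute)
  finally have eq: "radial_integral \<sigma> \<Psi> \<eta> * \<Phi> = radial_integral \<sigma> ?\<Psi> \<eta> * \<Phi>" .
  have "\<Phi> \<le> (\<integral>\<^sup>+x. indicator (ball (0 :: real ^ 'm) 2) x \<partial>lborel)"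
    unfolding \<Phi>_def
  proof (rule nn_integral_mono)
    fix x :: "real ^ 'm"
    show "?\<phi> (norm x) * ennreal (norm x powr - ?N) \<le> indicator (ball 0 2) x"
      using ge_one_powr_ge_zero[of "norm x" ?N] by (auto simp: indicator_def powr_minus intro!: inverse_le_1_iff[THEN iffD2])
  qed
  also have "\<dots> < \<infinity>" using emeasure_lborel_ball_finite[of "0 :: real ^ 'm" 2] by simp
  finally have fin: "\<Phi> \<noteq> \<infinity>" by simp
  have "\<Phi> \<noteq> 0"
  proof
    assume "\<Phi> = 0"
    then have "AE x in lborel. ?\<phi> (norm x) * ennreal (norm (x :: real ^ 'm) powr - ?N) = 0"
      unfolding \<Phi>_def by (subst (asm) nn_integral_0_iff_AE) auto
    then have "AE x in lborel. \<not> (norm (x :: real ^ 'm) \<in> {1<..<2})"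
      by (rule AE_mp) (auto intro!: AE_I2)
    then have "emeasure lborel {x :: real ^ 'm. norm x \<in> {1<..<2}} = 0"
      by (subst (asm) AE_iff_measurable[OF _ refl]) auto
    moreover have "open {x :: real ^ 'm. norm x \<in> {1<..<2}}"
      using open_vimage[of "{1<..<2::real}" norm] by (simp add: vimage_def continuous_on_norm_id)
    moreover have "{x :: real ^ 'm. norm x \<in> {1<..<2}} \<noteq> {}"
    proof -
      obtain x :: "real ^ 'm" where "norm x = 3 / 2"
        by (rule vector_choose_size[of "3 / 2 :: real"]) auto
      then have "x \<in> {x. norm x \<in> {1<..<2}}" by simp
      then show ?thesis by blast
    qed
    moreover have "negligible S" if "open S" "emeasure lborel S = 0" for S :: "(real ^ 'm) set"
      using that by (auto simp: negligible_iff_null_sets intro!: null_sets_completionI null_setsI)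
    ultimately show False
      using open_not_negligible by blast
  qed
  then show ?thesis
    using eq fin by (auto simp: ennreal_mult_cancel_left mult.commute[of _ \<Phi>])
qed

lemma radial_integral_unit_vector_independent:
  fixes \<eta> \<eta>' :: "real ^ 'm"
  assumes "norm \<eta> = 1" "norm \<eta>' = 1" and [measurable]: "\<Psi> \<in> borel_measurable borel"
  shows "radial_integral \<sigma> \<Psi> \<eta> = radial_integral \<sigma> \<Psi> \<eta>'"
proof -
  have "\<eta> \<noteq> 0" using assms(1) by auto
  from nn_integral_radial_kernel[OF _ assms(1) this, of \<Psi> \<sigma>] nn_integral_radial_kernel[OF _ assms(2) this, of \<Psi> \<sigma>]
  show ?thesis using assms(1) by simp
qed

lemma radial_integral_cong:
  "(\<And>r. 0 \<le> r \<Longrightarrow> \<Psi> r = \<Phi> r) \<Longrightarrow> radial_integral \<sigma> \<Psi> \<eta> = radial_integral \<sigma> \<Phi> \<eta>"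
  by (simp add: radial_integral_def)

lemma radial_integral_mono:
  "(\<And>r. 0 \<le> r \<Longrightarrow> \<Psi> r \<le> \<Phi> r) \<Longrightarrow> radial_integral \<sigma> \<Psi> \<eta> \<le> radial_integral \<sigma> \<Phi> \<eta>"
  unfolding radial_integral_def by (intro nn_integral_mono mult_right_mono) auto

lemma radial_integral_add:
  assumes [measurable]: "\<Psi> \<in> borel_measurable borel" "\<Phi> \<in> borel_measurable borel"
  shows "radial_integral \<sigma> (\<lambda>r. \<Psi> r + \<Phi> r) \<eta> = radial_integral \<sigma> \<Psi> \<eta> + radial_integral \<sigma> \<Phi> \<eta>"
  unfolding radial_integral_def by (simp add: nn_integral_add distrib_right)

lemma radial_integral_exterior_SUP:
  fixes l p \<sigma> :: real and \<eta> :: "'a::euclidean_space"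
  shows "radial_integral \<sigma> (\<lambda>r. ennreal (indicator {1<..} r * (1 - r powr - l) powr p)) \<eta>
    = (SUP n::nat. radial_integral \<sigma> (\<lambda>r. ennreal (indicator {1 + 1 / Suc n<..} r * (1 - r powr - l) powr p)) \<eta>)"
proof -
  let ?G = "\<lambda>r. ennreal ((1 - r powr - l) powr p)"
  let ?K = "\<lambda>u. ?G (norm u) * ennreal (norm (u - \<eta>) powr (- real DIM('a) - \<sigma>))"
  have ind: "ennreal (indicator A r * (1 - r powr - l) powr p) = indicator A r * ?G r" for A r
    by (simp add: indicator_def)
  have sup: "(SUP n::nat. indicator {1 + 1 / Suc n<..} r :: ennreal) = indicator {1<..} r" for r :: real
  proof (cases "1 < r")
    case True
    then obtain n :: nat where "inverse (real (Suc n)) < r - 1"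
      using reals_Archimedean[of "r - 1"] by auto
    then have "indicator {1<..} r = (indicator {1 + 1 / Suc n<..} r :: ennreal)"
      using True by (simp add: inverse_eq_divide)
    also have "\<dots> \<le> (SUP n::nat. indicator {1 + 1 / Suc n<..} r)"
      by (rule SUP_upper) simp
    finally have "indicator {1<..} r \<le> (SUP n::nat. indicator {1 + 1 / Suc n<..} r :: ennreal)" .
    moreover have "(SUP n::nat. indicator {1 + 1 / Suc n<..} r :: ennreal) \<le> indicator {1<..} r"
      using True by (intro SUP_least) (simp add: indicator_def)
    ultimately show ?thesis by (intro antisym)
  next
    case False
    then have "\<not> 1 + 1 / real (Suc n) < r" for n
      by (simp add: not_less add_increasing2)
    then have "(indicator {1 + 1 / real (Suc n)<..} r :: ennreal) = 0" for n
      by simp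
    then show ?thesis using False by simp
  qed
  have "(SUP n::nat. radial_integral \<sigma> (\<lambda>r. indicator {1 + 1 / Suc n<..} r * ?G r) \<eta>)
      = (SUP n::nat. \<integral>\<^sup>+u. indicator {1 + 1 / Suc n<..} (norm u) * ?K u \<partial>lborel)"
    by (simp add: radial_integral_def mult.assoc)
  also have "\<dots> = (\<integral>\<^sup>+u. (SUP n::nat. indicator {1 + 1 / Suc n<..} (norm u) * ?K u) \<partial>lborel)"
  proof (rule nn_integral_monotone_convergence_SUP[symmetric])
    show "incseq (\<lambda>n::nat. \<lambda>u. indicator {1 + 1 / Suc n<..} (norm u) * ?K u)"
    proof (intro monoI le_funI mult_right_mono)
      fix m n :: nat and u :: 'a assume "m \<le> n"
      then have "1 / real (Suc n) \<le> 1 / real (Suc m)" by (intro divide_left_mono) auto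
      then show "indicator {1 + 1 / Suc m<..} (norm u) \<le> (indicator {1 + 1 / Suc n<..} (norm u) :: ennreal)"
        by (auto simp: indicator_def)
    qed simp
  qed measurable
  also have "\<dots> = radial_integral \<sigma> (\<lambda>r. indicator {1<..} r * ?G r) \<eta>"
    by (simp only: radial_integral_def mult.assoc SUP_mult_right_ennreal[symmetric] sup)
  finally show ?thesis by (simp only: ind)
qed

text \<open>The condition on \<open>l\<close> makes the inversion exchange the parts \<open>r < 1\<close> and \<open>r > 1\<close> of the integral:
  \<open>|1 - r powr l| powr p * r powr (\<sigma> - N) = |1 - r powr - l| powr p\<close>.\<close>

lemma radial_integral_eq_twice_exterior:
  fixes \<eta> :: "real ^ 'm"
  assumes \<eta>: "norm \<eta> = 1" and lp: "l * p = real CARD('m) - \<sigma>" and l: "0 < l"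
  shows "radial_integral \<sigma> (\<lambda>r. ennreal (\<bar>1 - r powr - l\<bar> powr p)) \<eta>
    = 2 * radial_integral \<sigma> (\<lambda>r. ennreal (indicator {1<..} r * (1 - r powr - l) powr p)) \<eta>"
proof -
  let ?A = "\<lambda>r. ennreal (indicator {1<..} r * (1 - r powr - l) powr p)"
  let ?B = "\<lambda>r. ennreal (indicator {..<1} r * \<bar>1 - r powr - l\<bar> powr p)"
  have lt: "r powr - l < 1" if "1 < r" for r :: real
    using that l powr_less_mono[of "- l" 0 r] by simp
  have "radial_integral \<sigma> ?B \<eta> = radial_integral \<sigma> (\<lambda>r. ?B (1 / r) * ennreal (r powr (\<sigma> - CARD('m)))) \<eta>"
    by (rule radial_integral_inversion[OF \<eta>]) measurable
  also have "\<dots> = radial_integral \<sigma> ?A \<eta>"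
  proof (rule radial_integral_cong)
    fix r :: real assume r: "0 \<le> r"
    show "?B (1 / r) * ennreal (r powr (\<sigma> - CARD('m))) = ?A r"
    proof (cases "1 < r")
      case True
      have "r powr (\<sigma> - CARD('m)) = (r powr - l) powr p"
        using lp by (simp add: powr_powr)
      then have "\<bar>1 - (1 / r) powr - l\<bar> powr p * r powr (\<sigma> - CARD('m)) = (\<bar>1 - r powr l\<bar> * r powr - l) powr p"
        using True by (simp add: powr_mult powr_minus powr_divide)
      also have "\<bar>1 - r powr l\<bar> * r powr - l = \<bar>r powr - l - 1\<bar>"
      proof -
        have "\<bar>1 - r powr l\<bar> * r powr - l = \<bar>(1 - r powr l) * r powr - l\<bar>"
          by (simp add: abs_mult)
        also have "(1 - r powr l) * r powr - l = r powr - l - 1"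
          using True by (simp add: left_diff_distrib powr_add[symmetric])
        finally show ?thesis .
      qed
      also have "\<dots> = 1 - r powr - l" using lt[OF True] by simp
      finally show ?thesis using True by (simp add: ennreal_mult[symmetric])
    next
      case False
      then have "r = 0 \<or> \<not> 1 / r < 1" using r by (auto simp: field_simps)
      then show ?thesis using False by auto
    qed
  qed
  finally have B: "radial_integral \<sigma> ?B \<eta> = radial_integral \<sigma> ?A \<eta>" .
  have "radial_integral \<sigma> (\<lambda>r. ennreal (\<bar>1 - r powr - l\<bar> powr p)) \<eta> = radial_integral \<sigma> (\<lambda>r. ?A r + ?B r) \<eta>"
  proof (rule radial_integral_cong)
    fix r :: real assume "0 \<le> r"
    show "ennreal (\<bar>1 - r powr - l\<bar> powr p) = ?A r + ?B r"
      using lt[of r] by (cases r "1 :: real" rule: linorder_cases) simp_all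
  qed
  also have "\<dots> = radial_integral \<sigma> ?A \<eta> + radial_integral \<sigma> ?B \<eta>"
    by (rule radial_integral_add) measurable
  finally show ?thesis by (simp add: B mult_2)
qed

section \<open>Integrability of powers of the norm\<close>

text \<open>The first factor is responsible for integrability at \<open>0\<close>, both together for integrability at
  infinity.\<close>

lemma nn_integral_powr_product_real_finite:
  fixes a b :: real
  assumes a: "0 \<le> a" "a < 1" and b: "0 \<le> b" "1 < a + b"
  shows "(\<integral>\<^sup>+s. ennreal (\<bar>s\<bar> powr - a * (1 + \<bar>s\<bar>) powr - b) \<partial>lborel) < \<infinity>"
proof -
  let ?h = "\<lambda>s. ennreal (\<bar>s\<bar> powr - a * (1 + \<bar>s\<bar>) powr - b)"
  let ?P = "\<lambda>s. ennreal (indicator {0..1} s * s powr - a) + ennreal (indicator {1..} s * s powr - (a + b))"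
  have 1: "(\<integral>\<^sup>+s. ennreal (indicator {0..1} s * s powr - a) \<partial>lborel) < \<infinity>"
    using nn_integral_has_integral_lebesgue[OF _ has_integral_powr_from_0[of "- a" 1]] a by auto
  have 2: "(\<integral>\<^sup>+s. ennreal (indicator {1..} s * s powr - (a + b)) \<partial>lborel) < \<infinity>"
    using nn_integral_has_integral_lebesgue[OF _ has_integral_powr_to_inf[of "- (a + b)" 1]] b by auto
  have P: "(\<integral>\<^sup>+s. ?P s \<partial>lborel) < \<infinity>"
    using 1 2 by (subst nn_integral_add) auto
  have P': "(\<integral>\<^sup>+s. ?P (- s) \<partial>lborel) = (\<integral>\<^sup>+s. ?P s \<partial>lborel)"
    using nn_integral_real_affine[of ?P "- 1" 0] by simp
  have bound: "?h s \<le> ?P s" if s: "0 \<le> s" for s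
  proof (cases "s \<le> 1")
    case True
    have "(1 + s) powr - b \<le> 1"
      using ge_one_powr_ge_zero[of "1 + s" b] s b by (simp add: powr_minus inverse_le_1_iff)
    then have "s powr - a * (1 + s) powr - b \<le> s powr - a"
      by (simp add: mult_left_le)
    then have "?h s \<le> ennreal (indicator {0..1} s * s powr - a)" using s True by (simp add: ennreal_leI)
    then show ?thesis by (simp add: add_increasing2)
  next
    case False
    then have "s powr - a * (1 + s) powr - b \<le> s powr - a * s powr - b"
      using b by (intro mult_left_mono powr_mono2') auto
    also have "\<dots> = s powr - (a + b)" by (simp add: powr_add[symmetric])
    finally have "?h s \<le> ennreal (indicator {1..} s * s powr - (a + b))" using s False by (simp add: ennreal_leI)
    then show ?thesis by (simp add: add_increasing)
  qed
  have "(\<integral>\<^sup>+s. ?h s \<partial>lborel) \<le> (\<integral>\<^sup>+s. ?P s + ?P (- s) \<partial>lborel)"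
  proof (rule nn_integral_mono)
    fix s :: real
    show "?h s \<le> ?P s + ?P (- s)"
    proof (cases "0 \<le> s")
      case True
      show ?thesis by (rule order_trans[OF bound[OF True] add_increasing2]) simp_all
    next
      case False
      have "?h s = ?h (- s)" by simp
      also have "\<dots> \<le> ?P (- s)" using False by (intro bound) simp
      finally show ?thesis by (rule order_trans[OF _ add_increasing]) simp_all
    qed
  qed
  also have "\<dots> = (\<integral>\<^sup>+s. ?P s \<partial>lborel) + (\<integral>\<^sup>+s. ?P (- s) \<partial>lborel)"
    by (rule nn_integral_add) measurable
  also have "\<dots> < \<infinity>" unfolding P' infinity_ennreal_def ennreal_add_less_top
    using P unfolding infinity_ennreal_def by (simp only: simp_thms)
  finally show ?thesis .
qed

text \<open>Since \<open>|x|\<close> dominates every coordinate, the integrand is at most a product of one-dimensional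
  integrands of the same form, with \<open>a\<close> and \<open>b\<close> divided by the dimension.\<close>

lemma nn_integral_norm_powr_product_finite:
  fixes a b :: real
  assumes a: "0 \<le> a" "a < DIM('a)" and b: "0 \<le> b" "DIM('a) < a + b"
  shows "(\<integral>\<^sup>+x. ennreal (norm (x :: 'a::euclidean_space) powr - a * (1 + norm x) powr - b) \<partial>lborel) < \<infinity>"
proof -
  let ?N = "real DIM('a)"
  let ?a = "a / ?N" and ?b = "b / ?N"
  let ?h = "\<lambda>s. \<bar>s\<bar> powr - ?a * (1 + \<bar>s\<bar>) powr - ?b"
  have N: "?N > 0" by simp
  have "(\<integral>\<^sup>+x. ennreal (norm (x :: 'a) powr - a * (1 + norm x) powr - b) \<partial>lborel)
      \<le> (\<integral>\<^sup>+x. (\<Prod>i\<in>Basis. ennreal (?h ((x :: 'a) \<bullet> i))) \<partial>lborel)"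
  proof (rule nn_integral_mono_AE)
    \<comment> \<open>At a vanishing coordinate the bound fails, because \<open>0 powr - a = 0\<close>.\<close>
    have "AE x in lborel. x \<bullet> i \<noteq> 0" if "i \<in> Basis" for i :: 'a
    proof -
      have "negligible {x. x \<bullet> i = 0}"
        using that by (intro negligible_standard_hyperplane)
      moreover have "closed {x. x \<bullet> i = 0}"
        using closed_hyperplane[of i 0] by (simp add: inner_commute)
      ultimately have "{x. x \<bullet> i = 0} \<in> null_sets lborel"
        by (auto simp: negligible_iff_null_sets null_sets_def)
      then show ?thesis by (auto intro: AE_I')
    qed
    then have "AE x in lborel. \<forall>i\<in>(Basis :: 'a set). x \<bullet> i \<noteq> 0"
      by (subst AE_finite_all) auto
    then show "AE x in lborel. ennreal (norm (x :: 'a) powr - a * (1 + norm x) powr - b)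
        \<le> (\<Prod>i\<in>Basis. ennreal (?h (x \<bullet> i)))"
    proof (rule AE_mp, intro AE_I2 impI)
      fix x :: 'a assume nz: "\<forall>i\<in>Basis. x \<bullet> i \<noteq> 0"
      have "norm x powr - a * (1 + norm x) powr - b = (\<Prod>i\<in>(Basis :: 'a set). norm x powr - ?a * (1 + norm x) powr - ?b)"
      proof -
        have "(c powr - (e / ?N)) ^ DIM('a) = c powr - e" if "c > 0" for c e :: real
          using that by (simp add: powr_realpow[symmetric] powr_powr del: powr_realpow)
        moreover have "x \<noteq> 0" using nz by auto
        ultimately show ?thesis by (simp add: power_mult_distrib add_pos_pos)
      qed
      also have "\<dots> \<le> (\<Prod>i\<in>Basis. ?h (x \<bullet> i))"
      proof (intro prod_mono conjI mult_mono)
        fix i :: 'a assume i: "i \<in> Basis"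
        show "norm x powr - ?a \<le> \<bar>x \<bullet> i\<bar> powr - ?a"
          using nz i a N Basis_le_norm[OF i, of x] by (intro powr_mono2') auto
        show "(1 + norm x) powr - ?b \<le> (1 + \<bar>x \<bullet> i\<bar>) powr - ?b"
          using b N Basis_le_norm[OF i, of x] by (intro powr_mono2') auto
      qed auto
      finally show "ennreal (norm x powr - a * (1 + norm x) powr - b)
        \<le> (\<Prod>i\<in>Basis. ennreal (?h (x \<bullet> i)))"
        by (subst prod_ennreal) (auto intro: ennreal_leI)
    qed
  qed
  also have "\<dots> = (\<Prod>i\<in>(Basis :: 'a set). (\<integral>\<^sup>+s. ennreal (?h s) \<partial>lborel))"
    by (rule nn_integral_lborel_prod) auto
  also have "\<dots> < \<infinity>"
  proof -
    have "?a < 1" using a N by simp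
    moreover have "1 < ?a + ?b" using b N by (simp add: add_divide_distrib[symmetric])
    ultimately have "(\<integral>\<^sup>+s. ennreal (?h s) \<partial>lborel) < \<infinity>"
      using a b N by (intro nn_integral_powr_product_real_finite) auto
    then show ?thesis by (simp add: power_less_top_ennreal)
  qed
  finally show ?thesis .
qed

lemma nn_integral_one_plus_norm_powr_finite:
  assumes b: "real DIM('a) < b"
  shows "(\<integral>\<^sup>+x. ennreal ((1 + norm (x :: 'a::euclidean_space)) powr - b) \<partial>lborel) < \<infinity>"
proof -
  have "(\<integral>\<^sup>+x. ennreal ((1 + norm (x :: 'a)) powr - b) \<partial>lborel)
      = (\<integral>\<^sup>+x. ennreal (norm (x :: 'a) powr - 0 * (1 + norm x) powr - b) \<partial>lborel)"
    by (rule nn_integral_cong_AE, rule AE_mp[OF AE_lborel_singleton[of 0]]) (auto intro!: AE_I2)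
  also have "\<dots> < \<infinity>"
    using b by (intro nn_integral_norm_powr_product_finite) auto
  finally show ?thesis .
qed

text \<open>On \<open>|u| > s\<close> the distance from \<open>u\<close> to \<open>\<eta>\<close> is comparable to \<open>1 + |u|\<close>.\<close>

lemma radial_integral_exterior_finite:
  fixes \<eta> :: "'a::euclidean_space"
  assumes \<eta>: "norm \<eta> = 1" and s: "1 < s" and \<sigma>: "0 < \<sigma>"
  shows "radial_integral \<sigma> (indicator {s<..}) \<eta> < \<infinity>"
proof -
  let ?q = "- real DIM('a) - \<sigma>" and ?c = "(s - 1) / (s + 1)"
  have c: "0 < ?c" using s by simp
  have "radial_integral \<sigma> (indicator {s<..}) \<eta>
      \<le> (\<integral>\<^sup>+u. ennreal (?c powr ?q) * ennreal ((1 + norm (u :: 'a)) powr - (DIM('a) + \<sigma>)) \<partial>lborel)"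
    unfolding radial_integral_def
  proof (rule nn_integral_mono)
    fix u :: 'a
    show "indicator {s<..} (norm u) * ennreal (norm (u - \<eta>) powr ?q)
      \<le> ennreal (?c powr ?q) * ennreal ((1 + norm u) powr - (DIM('a) + \<sigma>))"
    proof (cases "s < norm u")
      case True
      have "?c * (1 + norm u) \<le> norm u - 1"
        using True s by (simp add: field_simps)
      also have "\<dots> \<le> norm (u - \<eta>)"
        using norm_triangle_ineq2[of u \<eta>] \<eta> by simp
      finally have "norm (u - \<eta>) powr ?q \<le> (?c * (1 + norm u)) powr ?q"
        using s \<sigma> by (intro powr_mono2') (auto intro!: mult_pos_pos divide_pos_pos add_pos_nonneg)
      also have "\<dots> = ?c powr ?q * (1 + norm u) powr - (DIM('a) + \<sigma>)"
        by (subst powr_mult) (use s in auto)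
      finally show ?thesis using True by (simp add: ennreal_mult[symmetric] ennreal_leI)
    qed simp
  qed
  also have "\<dots> = ennreal (?c powr ?q) * (\<integral>\<^sup>+u. ennreal ((1 + norm (u :: 'a)) powr - (DIM('a) + \<sigma>)) \<partial>lborel)"
    by (rule nn_integral_cmult) measurable
  also have "\<dots> < \<infinity>"
    using nn_integral_one_plus_norm_powr_finite[of "DIM('a) + \<sigma>", where 'a = 'a] \<sigma>
    by (simp add: ennreal_mult_less_top)
  finally show ?thesis .
qed

section \<open>Integrating the kernel along the centre\<close>

lemma nn_integral_gaussian:
  assumes u: "0 < u"
  shows "(\<integral>\<^sup>+s. ennreal (exp (- (u * s\<^sup>2))) \<partial>lborel) = ennreal (sqrt (pi / u))"
proof -
  define \<sigma> where "\<sigma> = sqrt (1 / (2 * u))"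
  have \<sigma>: "\<sigma> > 0" "\<sigma>\<^sup>2 = 1 / (2 * u)" using u by (auto simp: \<sigma>_def)
  have "ennreal (exp (- (u * s\<^sup>2))) = ennreal (sqrt (pi / u)) * ennreal (normal_density 0 \<sigma> s)" for s
    using u by (simp add: normal_density_def \<sigma> ennreal_mult[symmetric] real_sqrt_divide mult.commute)
  then have "(\<integral>\<^sup>+s. ennreal (exp (- (u * s\<^sup>2))) \<partial>lborel)
      = ennreal (sqrt (pi / u)) * (\<integral>\<^sup>+s. ennreal (normal_density 0 \<sigma> s) \<partial>lborel)"
    by (simp add: nn_integral_cmult)
  also have "(\<integral>\<^sup>+s. ennreal (normal_density 0 \<sigma> s) \<partial>lborel) = 1"
    using \<sigma> by (subst nn_integral_eq_integral) auto
  finally show ?thesis by simp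
qed

lemma nn_integral_Gamma_scaled:
  assumes a: "0 < a" and c: "0 < c"
  shows "(\<integral>\<^sup>+u. ennreal (indicator {0..} u * u powr (a - 1) * exp (- (c * u))) \<partial>lborel)
    = ennreal (Gamma a * c powr - a)"
proof -
  have "ennreal (Gamma a) = (\<integral>\<^sup>+u. ennreal (indicator {0..} u * u powr (a - 1) / exp u) \<partial>lborel)"
    by (rule Gamma_conv_nn_integral_real[OF a])
  also have "\<dots> = ennreal c * (\<integral>\<^sup>+u. ennreal (indicator {0..} (c * u) * (c * u) powr (a - 1) / exp (c * u)) \<partial>lborel)"
    using c by (subst nn_integral_real_affine[of _ c 0]) auto
  also have "(\<integral>\<^sup>+u. ennreal (indicator {0..} (c * u) * (c * u) powr (a - 1) / exp (c * u)) \<partial>lborel)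
      = (\<integral>\<^sup>+u. ennreal (c powr (a - 1)) * ennreal (indicator {0..} u * u powr (a - 1) * exp (- (c * u))) \<partial>lborel)"
    using c by (intro nn_integral_cong)
      (auto simp: indicator_def zero_le_mult_iff powr_mult ennreal_mult[symmetric] exp_minus field_simps)
  also have "\<dots> = ennreal (c powr (a - 1)) *
      (\<integral>\<^sup>+u. ennreal (indicator {0..} u * u powr (a - 1) * exp (- (c * u))) \<partial>lborel)"
    by (rule nn_integral_cmult) measurable
  finally have eq: "ennreal (Gamma a) = ennreal (c * c powr (a - 1)) *
      (\<integral>\<^sup>+u. ennreal (indicator {0..} u * u powr (a - 1) * exp (- (c * u))) \<partial>lborel)" (is "_ = _ * ?I")
    using c by (simp add: ennreal_mult mult.assoc)
  have "c * c powr (a - 1) = c powr a" using c by (simp add: powr_mult_base)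
  with eq have "ennreal (c powr - a) * ennreal (Gamma a) = ennreal (c powr - a) * (ennreal (c powr a) * ?I)"
    by simp
  also have "\<dots> = ennreal (c powr - a * c powr a) * ?I"
    by (simp add: ennreal_mult mult.assoc)
  also have "c powr - a * c powr a = 1" using c by (simp add: powr_add[symmetric])
  finally show ?thesis
    using Gamma_real_pos[OF a] by (simp add: ennreal_mult[symmetric] mult.commute)
qed

text \<open>Writing \<open>Gamma \<mu> * (1 + s\<^sup>2) powr - \<mu>\<close> as the integral of \<open>u powr (\<mu> - 1) * exp (- (1 + s\<^sup>2) u)\<close>, the
  integral over \<open>s\<close> becomes Gaussian and leaves a Gamma integral with parameter \<open>\<mu> - 1 / 2\<close>.\<close>

lemma nn_integral_one_plus_square_powr:
  assumes \<mu>: "1 / 2 < \<mu>"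
  shows "(\<integral>\<^sup>+s. ennreal ((1 + s\<^sup>2) powr - \<mu>) \<partial>lborel)
    = ennreal (sqrt pi * Gamma (\<mu> - 1 / 2) / Gamma \<mu>)"
proof -
  let ?g = "\<lambda>u s :: real. ennreal (indicator {0..} u * u powr (\<mu> - 1) * exp (- ((1 + s\<^sup>2) * u)))"
  have G: "Gamma \<mu> > 0" "Gamma (\<mu> - 1 / 2) > 0" using \<mu> by (auto intro: Gamma_real_pos)
  have "ennreal (Gamma \<mu>) * (\<integral>\<^sup>+s. ennreal ((1 + s\<^sup>2) powr - \<mu>) \<partial>lborel)
      = (\<integral>\<^sup>+s. ennreal (Gamma \<mu>) * ennreal ((1 + s\<^sup>2) powr - \<mu>) \<partial>lborel)"
    by (rule nn_integral_cmult[symmetric]) measurable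
  also have "\<dots> = (\<integral>\<^sup>+s. (\<integral>\<^sup>+u. ?g u s \<partial>lborel) \<partial>lborel)"
  proof (rule nn_integral_cong)
    fix s :: real
    have "0 < 1 + s\<^sup>2" by (simp add: add_pos_nonneg)
    then show "ennreal (Gamma \<mu>) * ennreal ((1 + s\<^sup>2) powr - \<mu>) = (\<integral>\<^sup>+u. ?g u s \<partial>lborel)"
      using nn_integral_Gamma_scaled[of \<mu> "1 + s\<^sup>2"] \<mu> G by (simp add: ennreal_mult)
  qed
  also have "\<dots> = (\<integral>\<^sup>+u. (\<integral>\<^sup>+s. ?g u s \<partial>lborel) \<partial>lborel)"
    by (rule lborel_pair.Fubini') measurable
  also have "\<dots> = (\<integral>\<^sup>+u. ennreal (sqrt pi) *
      ennreal (indicator {0..} u * u powr (\<mu> - 1 / 2 - 1) * exp (- (1 * u))) \<partial>lborel)"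
  proof (rule nn_integral_cong_AE, rule AE_mp[OF AE_lborel_singleton[of 0]], rule AE_I2, rule impI)
    fix u :: real assume u: "u \<noteq> 0"
    show "(\<integral>\<^sup>+s. ?g u s \<partial>lborel) = ennreal (sqrt pi) *
      ennreal (indicator {0..} u * u powr (\<mu> - 1 / 2 - 1) * exp (- (1 * u)))"
    proof (cases "u > 0")
      case True
      have "(\<integral>\<^sup>+s. ?g u s \<partial>lborel)
          = (\<integral>\<^sup>+s. ennreal (u powr (\<mu> - 1) * exp (- u)) * ennreal (exp (- (u * s\<^sup>2))) \<partial>lborel)"
        using True by (intro nn_integral_cong)
          (simp add: ennreal_mult[symmetric] exp_add[symmetric] algebra_simps)
      also have "\<dots> = ennreal (u powr (\<mu> - 1) * exp (- u)) * ennreal (sqrt (pi / u))"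
        by (subst nn_integral_cmult) (simp_all add: nn_integral_gaussian[OF True])
      also have "\<dots> = ennreal (sqrt pi * (u powr (\<mu> - 1) * u powr (- (1 / 2)) * exp (- u)))"
        using True by (simp add: ennreal_mult[symmetric] real_sqrt_divide powr_minus powr_half_sqrt field_simps)
      also have "u powr (\<mu> - 1) * u powr (- (1 / 2)) = u powr (\<mu> - 1 / 2 - 1)"
        by (simp add: powr_add[symmetric] algebra_simps)
      finally show ?thesis using True by (simp add: ennreal_mult[symmetric])
    qed (use u in simp)
  qed
  also have "\<dots> = ennreal (sqrt pi) * ennreal (Gamma (\<mu> - 1 / 2) * 1 powr - (\<mu> - 1 / 2))"
    using \<mu> by (subst nn_integral_cmult, measurable, subst nn_integral_Gamma_scaled) auto
  finally have "ennreal (Gamma \<mu>) * (\<integral>\<^sup>+s. ennreal ((1 + s\<^sup>2) powr - \<mu>) \<partial>lborel)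
      = ennreal (Gamma \<mu>) * ennreal (sqrt pi * Gamma (\<mu> - 1 / 2) / Gamma \<mu>)"
    using G by (simp add: ennreal_mult[symmetric])
  then show ?thesis using G by (simp add: ennreal_mult_cancel_left)
qed

lemma nn_integral_vertical_kernel:
  assumes \<mu>: "1 / 2 < \<mu>" and m: "0 < m"
  shows "(\<integral>\<^sup>+s. ennreal ((m ^ 4 + s\<^sup>2) powr - \<mu>) \<partial>lborel)
    = ennreal (sqrt pi * Gamma (\<mu> - 1 / 2) / Gamma \<mu>) * ennreal (m powr (2 - 4 * \<mu>))"
proof -
  have "(\<integral>\<^sup>+s. ennreal ((m ^ 4 + s\<^sup>2) powr - \<mu>) \<partial>lborel)
      = ennreal (m\<^sup>2) * (\<integral>\<^sup>+s. ennreal ((m ^ 4 + (m\<^sup>2 * s)\<^sup>2) powr - \<mu>) \<partial>lborel)"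
    using m by (subst nn_integral_real_affine[of _ "m\<^sup>2" 0]) auto
  also have "(\<lambda>s. ennreal ((m ^ 4 + (m\<^sup>2 * s)\<^sup>2) powr - \<mu>))
      = (\<lambda>s. ennreal (m powr (- 4 * \<mu>)) * ennreal ((1 + s\<^sup>2) powr - \<mu>))"
  proof
    fix s
    have "m ^ 4 + (m\<^sup>2 * s)\<^sup>2 = m ^ 4 * (1 + s\<^sup>2)"
      by (simp add: power_mult_distrib algebra_simps)
    moreover have "(m ^ 4) powr - \<mu> = m powr (- 4 * \<mu>)"
    proof -
      have "m ^ 4 = m powr 4" using m by simp
      then show ?thesis by (simp only: powr_powr) simp
    qed
    ultimately show "ennreal ((m ^ 4 + (m\<^sup>2 * s)\<^sup>2) powr - \<mu>)
        = ennreal (m powr (- 4 * \<mu>)) * ennreal ((1 + s\<^sup>2) powr - \<mu>)"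
      by (simp add: powr_mult ennreal_mult)
  qed
  also have "ennreal (m\<^sup>2) * (\<integral>\<^sup>+s. ennreal (m powr (- 4 * \<mu>)) * ennreal ((1 + s\<^sup>2) powr - \<mu>) \<partial>lborel)
      = ennreal (m\<^sup>2 * m powr (- 4 * \<mu>)) * ennreal (sqrt pi * Gamma (\<mu> - 1 / 2) / Gamma \<mu>)"
    by (subst nn_integral_cmult) (simp_all add: nn_integral_one_plus_square_powr[OF \<mu>] ennreal_mult mult.assoc)
  also have "m\<^sup>2 * m powr (- 4 * \<mu>) = m powr (2 - 4 * \<mu>)"
  proof -
    have "m\<^sup>2 = m powr 2" using m by simp
    then show ?thesis by (simp only: powr_add[symmetric]) simp
  qed
  finally show ?thesis by (simp add: mult.commute)
qed

section \<open>Distance and Haar measure of the Heisenberg group\<close>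

lemma heis_dist_eq:
  "heis_dist (z, t) (z', t')
    = root 4 (norm (z - z') ^ 4 + (t - t' + 2 * Im (\<Sum>j\<in>UNIV. - z' $ j * cnj (z $ j)))\<^sup>2)"
  by (simp add: heis_dist_def heis_gauge_def heis_mult_def heis_inv_def algebra_simps)

lemma heis_dist_commute: "heis_dist w w' = heis_dist w' w"
proof -
  have anti: "Im (\<Sum>j\<in>UNIV. - z' $ j * cnj (z $ j)) = - Im (\<Sum>j\<in>UNIV. - z $ j * cnj (z' $ j))"
    for z z' :: "complex ^ 'n"
    by (simp add: sum_negf[symmetric] algebra_simps)
  have "(t - t' + 2 * Im (\<Sum>j\<in>UNIV. - z' $ j * cnj (z $ j)))\<^sup>2
      = (t' - t + 2 * Im (\<Sum>j\<in>UNIV. - z $ j * cnj (z' $ j)))\<^sup>2" for z z' :: "complex ^ 'n" and t t'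
    unfolding anti[of z' z] by (simp add: power2_eq_square algebra_simps)
  then show ?thesis
    by (cases w; cases w') (simp add: heis_dist_eq norm_minus_commute)
qed

text \<open>Points of the group carry the Borel sets of the product space as a whole, so the measurability of
  the projections is stated for these rather than for a product of sigma-algebras.\<close>

lemma borel_measurable_heis_fst [measurable]:
  "(fst :: 'n::finite heis \<Rightarrow> complex ^ 'n) \<in> borel_measurable borel"
  by (intro borel_measurable_continuous_onI continuous_on_fst continuous_on_id)

lemma borel_measurable_heis_snd [measurable]:
  "(snd :: 'n::finite heis \<Rightarrow> real) \<in> borel_measurable borel"
  by (intro borel_measurable_continuous_onI continuous_on_snd continuous_on_id)

lemma borel_measurable_heis_dist [measurable]:
  "(\<lambda>(w, w'). heis_dist w w') \<in> borel_measurable (borel \<Otimes>\<^sub>M (borel :: 'n::finite heis measure))"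
proof -
  have "continuous_on UNIV (\<lambda>(w, w' :: 'n heis). heis_dist w w')"
    unfolding case_prod_beta heis_dist_def heis_gauge_def heis_mult_def heis_inv_def
    by (auto intro!: continuous_intros)
  then show ?thesis
    unfolding borel_prod by (rule borel_measurable_continuous_onI)
qed

lemma heis_dist_powr:
  "heis_dist (z, t) (z', t') powr - (4 * \<mu>)
    = (norm (z - z') ^ 4 + (t - t' + 2 * Im (\<Sum>j\<in>UNIV. - z' $ j * cnj (z $ j)))\<^sup>2) powr - \<mu>"
proof -
  have "root 4 x powr - (4 * \<mu>) = x powr - \<mu>" if "0 \<le> x" for x
  proof (cases "x = 0")
    case False
    then have "root 4 x = x powr (1 / 4)"
      using that by (simp add: root_powr_inverse)
    then show ?thesis by (simp add: powr_powr)
  qed simp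
  then show ?thesis by (simp add: heis_dist_eq)
qed

text \<open>The integral of \<open>(1 + s\<^sup>2) powr - (q / 4)\<close>, that is, of \<open>d powr - q\<close> over a fibre of the centre at
  horizontal distance \<open>1\<close>.\<close>

definition vertical_const :: "real \<Rightarrow> real" where
  "vertical_const q = sqrt pi * Gamma (q / 4 - 1 / 2) / Gamma (q / 4)"

text \<open>The twist in the group law is only a translation of the central variable once \<open>z\<close> and \<open>z'\<close> are
  fixed.\<close>

lemma nn_integral_heis_fibre:
  assumes q: "2 < q" and zz: "z \<noteq> z'"
  shows "(\<integral>\<^sup>+t'. ennreal (heis_dist (z, t) (z', t') powr - q) \<partial>lborel)
    = ennreal (vertical_const q) * ennreal (norm (z - z') powr (2 - q))"
proof -
  let ?c = "t + 2 * Im (\<Sum>j\<in>UNIV. - z' $ j * cnj (z $ j))"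
  have "(\<integral>\<^sup>+t'. ennreal (heis_dist (z, t) (z', t') powr - q) \<partial>lborel)
      = (\<integral>\<^sup>+t'. ennreal ((norm (z - z') ^ 4 + (?c - t')\<^sup>2) powr - (q / 4)) \<partial>lborel)"
    using heis_dist_powr[of z t z' _ "q / 4"] by (simp add: algebra_simps)
  also have "\<dots> = (\<integral>\<^sup>+s. ennreal ((norm (z - z') ^ 4 + s\<^sup>2) powr - (q / 4)) \<partial>lborel)"
    by (subst nn_integral_real_affine[of _ "- 1" ?c]) simp_all
  also have "\<dots> = ennreal (vertical_const q) * ennreal (norm (z - z') powr (2 - q))"
    using nn_integral_vertical_kernel[of "q / 4" "norm (z - z')"] q zz by (simp add: vertical_const_def)
  finally show ?thesis .
qed

lemma nn_integral_heis_fubini: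
  assumes [measurable]: "g \<in> borel_measurable (borel :: 'n::finite heis measure)"
  shows "(\<integral>\<^sup>+w. g w \<partial>lborel) = (\<integral>\<^sup>+z. (\<integral>\<^sup>+t. g (z, t) \<partial>lborel) \<partial>lborel)"
proof -
  have "g \<in> borel_measurable (lborel \<Otimes>\<^sub>M lborel)"
    unfolding lborel_prod by simp
  then show ?thesis
    by (simp add: lborel_prod[symmetric] lborel.nn_integral_fst)
qed

text \<open>Integration over the centre reduces the claim to \<open>nn_integral_radial_kernel\<close>, as
  \<open>2 - q = - N - \<sigma>\<close> with \<open>N = 2 n\<close>.\<close>

lemma nn_integral_heis_radial_kernel:
  fixes w :: "'n::finite heis" and \<eta> :: "real ^ ('n + 'n)"
  assumes \<eta>: "norm \<eta> = 1" and \<sigma>: "0 < \<sigma>" and w: "fst w \<noteq> 0"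
    and [measurable]: "\<Psi> \<in> borel_measurable borel"
  defines "q \<equiv> 2 * real CARD('n) + 2 + \<sigma>"
  shows "(\<integral>\<^sup>+w'. \<Psi> (norm (fst w') / norm (fst w)) * ennreal (heis_dist w w' powr - q) \<partial>lborel)
    = ennreal (vertical_const q) * (ennreal (norm (fst w) powr - \<sigma>) * radial_integral \<sigma> \<Psi> \<eta>)"
proof -
  obtain z t where zt: "w = (z, t)" by (cases w)
  have q: "2 < q" using \<sigma> by (simp add: q_def)
  have q_eq: "2 - q = - (real CARD('n) * 2) - \<sigma>" by (simp add: q_def)
  have [measurable]: "(\<lambda>w'. heis_dist w w') \<in> borel_measurable borel"
    using measurable_compose[OF measurable_Pair1' borel_measurable_heis_dist, of w] by simp
  have "(\<integral>\<^sup>+w'. \<Psi> (norm (fst w') / norm (fst w)) * ennreal (heis_dist w w' powr - q) \<partial>lborel)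
      = (\<integral>\<^sup>+z'. (\<integral>\<^sup>+t'. \<Psi> (norm z' / norm z) * ennreal (heis_dist (z, t) (z', t') powr - q) \<partial>lborel) \<partial>lborel)"
    by (subst nn_integral_heis_fubini) (simp_all add: zt)
  also have "\<dots> = (\<integral>\<^sup>+z'. ennreal (vertical_const q) *
      (\<Psi> (norm z' / norm z) * ennreal (norm (z - z') powr (- real DIM(complex ^ 'n) - \<sigma>))) \<partial>lborel)"
  proof (rule nn_integral_cong_AE, rule AE_mp[OF AE_lborel_singleton[of z]], rule AE_I2, rule impI)
    fix z' :: "complex ^ 'n" assume "z' \<noteq> z"
    have [measurable]: "(\<lambda>t'. heis_dist (z, t) (z', t')) \<in> borel_measurable borel"
      unfolding heis_dist_eq by measurable
    show "(\<integral>\<^sup>+t'. \<Psi> (norm z' / norm z) * ennreal (heis_dist (z, t) (z', t') powr - q) \<partial>lborel)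
      = ennreal (vertical_const q) *
      (\<Psi> (norm z' / norm z) * ennreal (norm (z - z') powr (- real DIM(complex ^ 'n) - \<sigma>)))"
      using \<open>z' \<noteq> z\<close> nn_integral_heis_fibre[OF q, of z z' t]
      by (subst nn_integral_cmult) (simp_all add: q_eq mult_ac)
  qed
  also have "\<dots> = ennreal (vertical_const q) *
      (\<integral>\<^sup>+z'. \<Psi> (norm z' / norm z) * ennreal (norm (z - z') powr (- real DIM(complex ^ 'n) - \<sigma>)) \<partial>lborel)"
    by (rule nn_integral_cmult) measurable
  also have "(\<integral>\<^sup>+z'. \<Psi> (norm z' / norm z) * ennreal (norm (z - z') powr (- real DIM(complex ^ 'n) - \<sigma>)) \<partial>lborel)
      = ennreal (norm z powr - \<sigma>) * radial_integral \<sigma> \<Psi> \<eta>"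
    by (rule nn_integral_radial_kernel) (use w \<eta> in \<open>auto simp: zt\<close>)
  finally show ?thesis by (simp add: zt)
qed

lemma nn_integral_heis_haar_pair:
  fixes g :: "'n::finite heis \<Rightarrow> 'n heis \<Rightarrow> ennreal"
  assumes [measurable]: "(\<lambda>(w, w'). g w w') \<in> borel_measurable (borel \<Otimes>\<^sub>M borel)"
  shows "(\<integral>\<^sup>+(w, w'). g w w' \<partial>(heis_haar \<Otimes>\<^sub>M (heis_haar :: 'n heis measure)))
    = 4 ^ CARD('n) * (4 ^ CARD('n) * (\<integral>\<^sup>+w. (\<integral>\<^sup>+w'. g w w' \<partial>lborel) \<partial>lborel))"
proof -
  have S [measurable_cong]: "sets (heis_haar :: 'n heis measure) = sets borel"
    by (simp add: heis_haar_def)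
  have [measurable]: "(\<lambda>(w, w'). g w w') \<in> borel_measurable (heis_haar \<Otimes>\<^sub>M heis_haar)"
    unfolding measurable_cong_sets[OF sets_pair_measure_cong[OF S S] refl] by (rule assms)
  have "sigma_finite_measure (heis_haar :: 'n heis measure)"
  proof
    obtain A :: "'n heis set set" where "countable A" "A \<subseteq> sets lborel" "\<Union> A = space lborel"
        "\<forall>a\<in>A. emeasure lborel a \<noteq> \<infinity>"
      using lborel.sigma_finite_countable by blast
    then show "\<exists>A :: 'n heis set set. countable A \<and> A \<subseteq> sets heis_haar \<and> \<Union> A = space heis_haar
        \<and> (\<forall>a\<in>A. emeasure heis_haar a \<noteq> \<infinity>)"
      by (intro exI[of _ A]) (auto simp: heis_haar_def space_scale_measure ennreal_mult_eq_top_iff power_eq_top_ennreal)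
  qed
  then interpret H: sigma_finite_measure "heis_haar :: 'n heis measure" .
  have "(\<integral>\<^sup>+(w, w'). g w w' \<partial>(heis_haar \<Otimes>\<^sub>M (heis_haar :: 'n heis measure)))
      = (\<integral>\<^sup>+w. (\<integral>\<^sup>+w'. g w w' \<partial>heis_haar) \<partial>heis_haar)"
    by (subst H.nn_integral_fst[symmetric]) auto
  also have "\<dots> = (\<integral>\<^sup>+w. 4 ^ CARD('n) * (\<integral>\<^sup>+w'. g w w' \<partial>lborel) \<partial>heis_haar)"
    unfolding heis_haar_def by (intro nn_integral_cong) (subst nn_integral_scale_measure, auto)
  also have "\<dots> = 4 ^ CARD('n) * (\<integral>\<^sup>+w. 4 ^ CARD('n) * (\<integral>\<^sup>+w'. g w w' \<partial>lborel) \<partial>lborel)"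
    unfolding heis_haar_def by (subst nn_integral_scale_measure) auto
  also have "(\<integral>\<^sup>+w. 4 ^ CARD('n) * (\<integral>\<^sup>+w'. g w w' \<partial>lborel) \<partial>lborel)
      = 4 ^ CARD('n) * (\<integral>\<^sup>+w. (\<integral>\<^sup>+w'. g w w' \<partial>lborel) \<partial>lborel)"
    by (rule nn_integral_cmult) measurable
  finally show ?thesis .
qed

section \<open>The energy off a dilation-invariant neighbourhood of the diagonal\<close>

text \<open>For \<open>x > y > 0\<close>, \<open>x\<close> is the convex combination of \<open>(x - y) / (1 - t)\<close> and \<open>y / t\<close> with weights
  \<open>1 - t\<close> and \<open>t\<close>, and \<open>x powr p\<close> is convex. For \<open>x \<le> y\<close> the second term on the right already suffices.
  Equality holds for \<open>y = t * x\<close>, which is the relation between the values of a ground state.\<close>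

lemma ground_state_inequality:
  fixes x y t p :: real
  assumes t: "0 < t" "t < 1" and xy: "0 \<le> x" "0 \<le> y" and p: "1 \<le> p"
  shows "x powr p * (1 - t) powr (p - 1)
    \<le> \<bar>x - y\<bar> powr p + y powr p * ((1 - t) powr (p - 1) * t powr (1 - p))"
proof (cases "x \<le> y")
  case True
  have "t powr (p - 1) \<le> 1 powr (p - 1)"
    using t p by (intro powr_mono2) auto
  then have "1 \<le> t powr (1 - p)"
    using t by (simp add: powr_minus_divide[of t "p - 1", simplified] field_simps)
  then have "x powr p * (1 - t) powr (p - 1) \<le> y powr p * ((1 - t) powr (p - 1) * t powr (1 - p))"
    using True xy p t by (intro mult_mono powr_mono2) (auto simp: mult_le_cancel_left1)
  then show ?thesis by (simp add: add_increasing)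
next
  case False
  show ?thesis
  proof (cases "y = 0")
    case True
    have "(1 - t) powr (p - 1) \<le> 1 powr (p - 1)"
      using t p by (intro powr_mono2) auto
    then show ?thesis using True xy p by (simp add: mult_left_le)
  next
    case y: False
    let ?a = "(x - y) / (1 - t)" and ?b = "y / t"
    have pos: "?a > 0" "?b > 0" using False y xy t by auto
    have "((1 - t) *\<^sub>R ?a + t *\<^sub>R ?b) powr p \<le> (1 - t) * ?a powr p + t * ?b powr p"
      using convex_onD[OF powr_convex[OF p], of t ?a ?b] pos t by auto
    also have "(1 - t) *\<^sub>R ?a + t *\<^sub>R ?b = x" using t by simp
    also have "(1 - t) * ?a powr p = (x - y) powr p * (1 - t) powr (1 - p)"
      using t False by (simp add: powr_divide powr_diff)
    also have "t * ?b powr p = y powr p * t powr (1 - p)"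
      using t xy by (simp add: powr_divide powr_diff)
    finally have "x powr p * (1 - t) powr (p - 1)
        \<le> ((x - y) powr p * (1 - t) powr (1 - p) + y powr p * t powr (1 - p)) * (1 - t) powr (p - 1)"
      by (intro mult_right_mono) auto
    also have "\<dots> = (x - y) powr p * ((1 - t) powr (1 - p) * (1 - t) powr (p - 1))
        + y powr p * ((1 - t) powr (p - 1) * t powr (1 - p))"
      by (simp add: algebra_simps)
    also have "(1 - t) powr (1 - p) * (1 - t) powr (p - 1) = 1"
      using t by (simp add: powr_add[symmetric])
    finally show ?thesis using False by simp
  qed
qed

lemma
  fixes f :: "'a::euclidean_space \<Rightarrow> 'b::real_normed_vector"
  assumes "schwartz f"
  shows schwartz_continuous: "continuous_on UNIV f"
    and schwartz_decay: "\<exists>C. \<forall>x. (1 + norm x) ^ k * norm (f x) \<le> C"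
proof -
  have *: "(\<forall>x. f differentiable (at x)) \<and> (\<forall>k::nat. \<exists>C::real. \<forall>x. (1 + norm x) ^ k * norm (f x) \<le> C)"
    using assms[unfolded schwartz_def, THEN spec[of _ "[]"]] by simp
  then show "continuous_on UNIV f"
    by (auto intro!: continuous_at_imp_continuous_on differentiable_imp_continuous_within)
  show "\<exists>C. \<forall>x. (1 + norm x) ^ k * norm (f x) \<le> C"
    using * by blast
qed

text \<open>The rapid decay of \<open>f\<close> leaves the local singularity \<open>|z| powr - \<sigma>\<close>, which is integrable for
  \<open>\<sigma> < 2 n\<close>. Finiteness is what allows a common term to be cancelled in \<open>heis_energy_exterior_cone\<close>.\<close>

lemma schwartz_weighted_integral_finite:
  fixes f :: "'n::finite heis \<Rightarrow> complex"
  assumes f: "schwartz f" and p: "1 \<le> p" and \<sigma>: "0 < \<sigma>" "\<sigma> < 2 * real CARD('n)"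
  shows "(\<integral>\<^sup>+w. ennreal (norm (fst w) powr - \<sigma> * norm (f w) powr p) \<partial>lborel) < \<infinity>"
proof -
  define k where "k = 2 * CARD('n) + 2"
  obtain C where C: "\<And>w. (1 + norm w) ^ k * norm (f w) \<le> C"
    using schwartz_decay[OF f] by blast
  have C0: "0 \<le> C" using C[of 0] by (rule order_trans[rotated]) simp
  have decay: "norm (f w) powr p
      \<le> C powr p * ((1 + norm (fst w)) powr - (2 * real CARD('n)) * (1 + norm (snd w)) powr - 2)" for w
  proof -
    have pos: "1 + norm w > 0" by (simp add: add_pos_nonneg)
    have "norm (f w) \<le> C * (1 + norm w) powr - real k"
    proof -
      have "norm (f w) = (1 + norm w) ^ k * norm (f w) * (1 + norm w) powr - real k"
        using pos by (simp add: powr_minus powr_realpow)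
      also have "\<dots> \<le> C * (1 + norm w) powr - real k"
        by (intro mult_right_mono C) simp
      finally show ?thesis .
    qed
    then have "norm (f w) powr p \<le> (C * (1 + norm w) powr - real k) powr p"
      using p by (intro powr_mono2) auto
    also have "\<dots> = C powr p * (1 + norm w) powr (- real k * p)"
      using C0 by (simp add: powr_mult powr_powr)
    also have "(1 + norm w) powr (- real k * p) \<le> (1 + norm w) powr - real k"
      using p mult_left_mono[of 1 p "real k"] by (intro powr_mono) auto
    also have "- real k = - (2 * real CARD('n)) + - 2" by (simp add: k_def)
    also have "(1 + norm w) powr (- (2 * real CARD('n)) + - 2)
        = (1 + norm w) powr - (2 * real CARD('n)) * (1 + norm w) powr - 2"
      by (rule powr_add)
    also have "\<dots> \<le> (1 + norm (fst w)) powr - (2 * real CARD('n)) * (1 + norm (snd w)) powr - 2"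
      using norm_fst_le[of "fst w" "snd w"] norm_snd_le[of "snd w" "fst w"]
      by (intro mult_mono powr_mono2') (auto simp: add_pos_nonneg)
    finally show ?thesis by (simp add: mult_left_mono)
  qed
  have "(\<integral>\<^sup>+w. ennreal (norm (fst w) powr - \<sigma> * norm (f w) powr p) \<partial>lborel)
      \<le> (\<integral>\<^sup>+w. ennreal (C powr p) * (ennreal (norm (fst w :: complex ^ 'n) powr - \<sigma> * (1 + norm (fst w)) powr - (2 * real CARD('n)))
          * ennreal ((1 + norm (snd w :: real)) powr - 2)) \<partial>lborel)"
  proof (rule nn_integral_mono)
    fix w :: "'n heis"
    have "norm (fst w) powr - \<sigma> * norm (f w) powr p \<le> norm (fst w) powr - \<sigma> *
        (C powr p * ((1 + norm (fst w)) powr - (2 * real CARD('n)) * (1 + norm (snd w)) powr - 2))"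
      by (intro mult_left_mono decay) simp
    then show "ennreal (norm (fst w) powr - \<sigma> * norm (f w) powr p) \<le> ennreal (C powr p) *
        (ennreal (norm (fst w) powr - \<sigma> * (1 + norm (fst w)) powr - (2 * real CARD('n)))
          * ennreal ((1 + norm (snd w)) powr - 2))"
      by (simp add: ennreal_mult[symmetric] mult_ac ennreal_leI)
  qed
  also have "\<dots> = ennreal (C powr p) * (\<integral>\<^sup>+w. ennreal (norm (fst w :: complex ^ 'n) powr - \<sigma> * (1 + norm (fst w)) powr - (2 * real CARD('n)))
          * ennreal ((1 + norm (snd w :: real)) powr - 2) \<partial>lborel)"
    by (rule nn_integral_cmult) measurable
  also have "(\<integral>\<^sup>+w. ennreal (norm (fst w :: complex ^ 'n) powr - \<sigma> * (1 + norm (fst w)) powr - (2 * real CARD('n)))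
          * ennreal ((1 + norm (snd w :: real)) powr - 2) \<partial>lborel)
      = (\<integral>\<^sup>+z. (\<integral>\<^sup>+t. ennreal (norm (z :: complex ^ 'n) powr - \<sigma> * (1 + norm z) powr - (2 * real CARD('n)))
        * ennreal ((1 + norm (t :: real)) powr - 2) \<partial>lborel) \<partial>lborel)"
    by (subst nn_integral_heis_fubini) simp_all
  also have "\<dots> = (
      (\<integral>\<^sup>+z. ennreal (norm (z :: complex ^ 'n) powr - \<sigma> * (1 + norm z) powr - (2 * real CARD('n))) \<partial>lborel)
        * (\<integral>\<^sup>+t. ennreal ((1 + norm (t :: real)) powr - 2) \<partial>lborel))"
    by (simp add: nn_integral_cmult nn_integral_multc)
  also have "ennreal (C powr p) * \<dots> < \<infinity>"
    using nn_integral_norm_powr_product_finite[of \<sigma> "2 * real CARD('n)", where 'a = "complex ^ 'n"]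
      nn_integral_one_plus_norm_powr_finite[of 2, where 'a = real] \<sigma>
    by (simp add: ennreal_mult_less_top mult.commute)
  finally show ?thesis .
qed

text \<open>The ground state inequality integrated over the region \<open>|z'| > s |z|\<close>. Let \<open>E\<close> be the energy of
  this region. The terms at \<open>w\<close> and \<open>w'\<close> give, up to the common factor, the radial integrals of
  \<open>\<Psi>1\<close> and, after inversion, of \<open>\<Psi>3\<close>. Since \<open>\<Psi>1 = \<Psi>0 + \<Psi>3\<close> and the integral of \<open>\<Psi>3\<close> is finite, it cancels
  and only \<open>\<Psi>0\<close> is left. For \<open>z = 0\<close> the quotient \<open>|z'| / |z|\<close> is \<open>0\<close> by convention, so these points
  are outside the region.\<close>

lemma heis_energy_exterior_cone:
  fixes f :: "'n::finite heis \<Rightarrow> complex" and \<eta> :: "real ^ ('n + 'n)"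
  assumes [measurable]: "f \<in> borel_measurable borel"
    and \<eta>: "norm \<eta> = 1" and p: "1 \<le> p" and \<sigma>: "0 < \<sigma>" "\<sigma> < 2 * real CARD('n)" and s: "1 < s"
  defines "l \<equiv> (2 * real CARD('n) - \<sigma>) / p" and "q \<equiv> 2 * real CARD('n) + 2 + \<sigma>"
  defines "M \<equiv> (\<integral>\<^sup>+w. ennreal (norm (fst w) powr - \<sigma> * norm (f w) powr p) \<partial>lborel)"
  assumes M: "M < \<infinity>"
  shows "ennreal (vertical_const q) * M * radial_integral \<sigma> (\<lambda>r. ennreal (indicator {s<..} r * (1 - r powr - l) powr p)) \<eta>
    \<le> (\<integral>\<^sup>+w. (\<integral>\<^sup>+w'. indicator {s<..} (norm (fst w') / norm (fst w)) *
          ennreal (norm (f w - f w') powr p * heis_dist w w' powr - q) \<partial>lborel) \<partial>lborel)"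
proof -
  let ?N = "2 * real CARD('n)"
  let ?b = "ennreal (vertical_const q)" and ?J = "\<lambda>\<Psi>. radial_integral \<sigma> \<Psi> \<eta>"
  let ?R = "\<lambda>w w' :: 'n heis. norm (fst w') / norm (fst w)"
  let ?k = "\<lambda>w w' :: 'n heis. ennreal (heis_dist w w' powr - q)"
  let ?F = "\<lambda>w. ennreal (norm (f w) powr p)"
  define \<Psi>0 where "\<Psi>0 = (\<lambda>r. ennreal (indicator {s<..} r * (1 - r powr - l) powr p))"
  define \<Psi>1 where "\<Psi>1 = (\<lambda>r. ennreal (indicator {s<..} r * (1 - r powr - l) powr (p - 1)))"
  define \<Psi>2 where "\<Psi>2 = (\<lambda>r. ennreal (indicator {s<..} r * ((1 - r powr - l) powr (p - 1) * (r powr - l) powr (1 - p))))"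
  define \<Psi>3 where "\<Psi>3 = (\<lambda>r. ennreal (indicator {s<..} r * ((1 - r powr - l) powr (p - 1) * r powr - l)))"
  have [measurable]: "\<Psi>0 \<in> borel_measurable borel" "\<Psi>1 \<in> borel_measurable borel"
      "\<Psi>2 \<in> borel_measurable borel" "\<Psi>3 \<in> borel_measurable borel"
    unfolding \<Psi>0_def \<Psi>1_def \<Psi>2_def \<Psi>3_def by measurable
  have lp: "0 < l" "l * p = ?N - \<sigma>" using p \<sigma> by (auto simp: l_def)
  have t: "0 < r powr - l" "r powr - l < 1" if "s < r" for r
    using that s lp powr_less_mono[of "- l" 0 r] by auto
  have Fm: "(\<integral>\<^sup>+w. ?F w * (?b * (ennreal (norm (fst w) powr - \<sigma>) * c)) \<partial>lborel) = ?b * M * c" for c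
  proof -
    have "(\<integral>\<^sup>+w. ?F w * (?b * (ennreal (norm (fst w) powr - \<sigma>) * c)) \<partial>lborel)
        = (\<integral>\<^sup>+w. ?b * (ennreal (norm (fst w) powr - \<sigma> * norm (f w) powr p) * c) \<partial>lborel)"
      by (intro nn_integral_cong) (simp add: ennreal_mult mult_ac)
    also have "\<dots> = ?b * (M * c)"
      unfolding M_def by (simp add: nn_integral_cmult nn_integral_multc)
    finally show ?thesis by (simp add: mult.assoc)
  qed
  \<comment> \<open>For \<open>z = 0\<close> both sides vanish: the left one by \<open>\<Psi> 0 = 0\<close>, the right one by \<open>0 powr - \<sigma> = 0\<close>.\<close>
  have radial: "(\<integral>\<^sup>+w. (\<integral>\<^sup>+w'. ?F w * (\<Psi> (?R w w') * ?k w w') \<partial>lborel) \<partial>lborel) = ?b * M * ?J \<Psi>"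
    if [measurable]: "\<Psi> \<in> borel_measurable borel" and "\<Psi> 0 = 0" for \<Psi>
  proof -
    have "(\<integral>\<^sup>+w'. ?F w * (\<Psi> (?R w w') * ?k w w') \<partial>lborel)
        = ?F w * (?b * (ennreal (norm (fst w) powr - \<sigma>) * ?J \<Psi>))" for w
    proof (cases "fst w = 0")
      case False
      then show ?thesis
        using nn_integral_heis_radial_kernel[OF \<eta> \<sigma>(1) False, of \<Psi>]
        by (subst nn_integral_cmult) (simp_all add: q_def)
    qed (simp add: that)
    then show ?thesis by (simp add: Fm)
  qed
  have "?b * M * ?J \<Psi>1 = (\<integral>\<^sup>+w. (\<integral>\<^sup>+w'. ?F w * (\<Psi>1 (?R w w') * ?k w w') \<partial>lborel) \<partial>lborel)"
    using s by (intro radial[symmetric]) (simp_all add: \<Psi>1_def)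
  also have "\<dots> \<le> (\<integral>\<^sup>+w. (\<integral>\<^sup>+w'. indicator {s<..} (?R w w') * ennreal (norm (f w - f w') powr p * heis_dist w w' powr - q)
        + ?F w' * (\<Psi>2 (?R w w') * ?k w w') \<partial>lborel) \<partial>lborel)"
  proof (intro nn_integral_mono)
    fix w w' :: "'n heis"
    show "?F w * (\<Psi>1 (?R w w') * ?k w w')
      \<le> indicator {s<..} (?R w w') * ennreal (norm (f w - f w') powr p * heis_dist w w' powr - q)
        + ?F w' * (\<Psi>2 (?R w w') * ?k w w')"
    proof (cases "s < ?R w w'")
      case True
      let ?t = "?R w w' powr - l"
      have "norm (f w) powr p * (1 - ?t) powr (p - 1)
          \<le> \<bar>norm (f w) - norm (f w')\<bar> powr p + norm (f w') powr p * ((1 - ?t) powr (p - 1) * ?t powr (1 - p))"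
        using t[OF True] p by (intro ground_state_inequality) auto
      also have "\<bar>norm (f w) - norm (f w')\<bar> powr p \<le> norm (f w - f w') powr p"
        using p by (intro powr_mono2 norm_triangle_ineq3) auto
      finally have "(norm (f w) powr p * (1 - ?t) powr (p - 1)) * heis_dist w w' powr - q
          \<le> (norm (f w - f w') powr p + norm (f w') powr p * ((1 - ?t) powr (p - 1) * ?t powr (1 - p)))
            * heis_dist w w' powr - q"
        by (intro mult_right_mono) auto
      then show ?thesis
        using True by (simp add: \<Psi>1_def \<Psi>2_def ennreal_mult[symmetric] ennreal_plus[symmetric] ennreal_leI
            algebra_simps del: ennreal_plus)
    qed (simp add: \<Psi>1_def)
  qed
  also have "\<dots> = (\<integral>\<^sup>+w. (\<integral>\<^sup>+w'. indicator {s<..} (?R w w') * ennreal (norm (f w - f w') powr p * heis_dist w w' powr - q) \<partial>lborel) \<partial>lborel)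
      + (\<integral>\<^sup>+w. (\<integral>\<^sup>+w'. ?F w' * (\<Psi>2 (?R w w') * ?k w w') \<partial>lborel) \<partial>lborel)"
    (is "_ = ?E + _")
    by (subst nn_integral_add[symmetric], measurable, subst nn_integral_add[symmetric], measurable)
  also have "(\<integral>\<^sup>+w. (\<integral>\<^sup>+w'. ?F w' * (\<Psi>2 (?R w w') * ?k w w') \<partial>lborel) \<partial>lborel)
      = (\<integral>\<^sup>+w'. (\<integral>\<^sup>+w. ?F w' * (\<Psi>2 (?R w w') * ?k w w') \<partial>lborel) \<partial>lborel)"
    by (rule lborel_pair.Fubini') measurable
  also have "\<dots> = (\<integral>\<^sup>+w'. (\<integral>\<^sup>+w. ?F w' * (\<Psi>2 (1 / ?R w' w) * ?k w' w) \<partial>lborel) \<partial>lborel)"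
    by (simp add: heis_dist_commute)
  also have "\<dots> = ?b * M * ?J (\<lambda>r. \<Psi>2 (1 / r))"
    using s by (intro radial) (simp_all add: \<Psi>2_def)
  also have "?J (\<lambda>r. \<Psi>2 (1 / r)) = ?J (\<lambda>r. \<Psi>2 r * ennreal (r powr (\<sigma> - ?N)))"
    by (subst radial_integral_inversion[OF \<eta>]) (simp_all add: card_UNIV_sum)
  also have "\<dots> = ?J \<Psi>3"
  proof (rule radial_integral_cong)
    fix r :: real
    have "(r powr - l) powr (1 - p) * r powr (\<sigma> - ?N) = r powr - l"
    proof -
      have "- l * (1 - p) + (\<sigma> - ?N) = - l" using lp(2) by (simp add: algebra_simps)
      then show ?thesis by (simp only: powr_powr powr_add[symmetric])
    qed
    then show "\<Psi>2 r * ennreal (r powr (\<sigma> - ?N)) = \<Psi>3 r"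
      by (simp add: \<Psi>2_def \<Psi>3_def ennreal_mult[symmetric] mult.assoc)
  qed
  finally have main: "?b * M * ?J \<Psi>1 \<le> ?E + ?b * M * ?J \<Psi>3" .
  have "\<Psi>1 r = \<Psi>0 r + \<Psi>3 r" for r
  proof (cases "s < r")
    case True
    have "(1 - r powr - l) powr p = (1 - r powr - l) powr (p - 1) * (1 - r powr - l)"
      using t[OF True] by (simp add: powr_diff)
    then show ?thesis
      using True t[OF True]
      by (simp add: \<Psi>0_def \<Psi>1_def \<Psi>3_def ennreal_plus[symmetric] algebra_simps del: ennreal_plus)
  qed (simp add: \<Psi>0_def \<Psi>1_def \<Psi>3_def)
  then have J1: "?J \<Psi>1 = ?J \<Psi>0 + ?J \<Psi>3"
    by (subst radial_integral_add[symmetric]) (auto intro: radial_integral_cong)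
  have "?J \<Psi>3 \<le> ?J (indicator {s<..})"
  proof (rule radial_integral_mono)
    fix r :: real
    show "\<Psi>3 r \<le> indicator {s<..} r"
    proof (cases "s < r")
      case True
      have "(1 - r powr - l) powr (p - 1) \<le> 1 powr (p - 1)"
        using t[OF True] p by (intro powr_mono2) auto
      then have "(1 - r powr - l) powr (p - 1) * r powr - l \<le> 1 * 1"
        using t[OF True] by (intro mult_mono) auto
      then show ?thesis using True by (simp add: \<Psi>3_def)
    qed (simp add: \<Psi>3_def)
  qed
  also have "\<dots> < \<infinity>" by (rule radial_integral_exterior_finite[OF \<eta> s \<sigma>(1)])
  finally have "?b * M * ?J \<Psi>3 < \<infinity>" using M by (simp add: ennreal_mult_less_top)
  moreover have "?b * M * ?J \<Psi>0 + ?b * M * ?J \<Psi>3 \<le> ?E + ?b * M * ?J \<Psi>3"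
    using main by (simp add: J1 distrib_left)
  ultimately have "?b * M * ?J \<Psi>0 \<le> ?E"
    by (auto simp: ennreal_add_left_cancel_le add.commute)
  then show ?thesis by (simp add: \<Psi>0_def)
qed

text \<open>The regions \<open>|z'| > s |z|\<close> and \<open>|z| > s |z'|\<close> are disjoint and contribute equally, since the integrand
  is symmetric.\<close>

lemma heis_energy_ge_twice_exterior_cone:
  fixes f :: "'n::finite heis \<Rightarrow> complex"
  assumes [measurable]: "f \<in> borel_measurable borel" and s: "1 < s"
  shows "2 * (\<integral>\<^sup>+w. (\<integral>\<^sup>+w'. indicator {s<..} (norm (fst w') / norm (fst w)) *
          ennreal (norm (f w - f w') powr p * heis_dist w w' powr - q) \<partial>lborel) \<partial>lborel)
    \<le> (\<integral>\<^sup>+w. (\<integral>\<^sup>+w'. ennreal (norm (f w - f w') powr p * heis_dist w w' powr - q) \<partial>lborel) \<partial>lborel)"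
proof -
  let ?R = "\<lambda>w w' :: 'n heis. norm (fst w') / norm (fst w)"
  let ?H = "\<lambda>w w' :: 'n heis. ennreal (norm (f w - f w') powr p * heis_dist w w' powr - q)"
  let ?E = "\<integral>\<^sup>+w. (\<integral>\<^sup>+w'. indicator {s<..} (?R w w') * ?H w w' \<partial>lborel) \<partial>lborel"
  have "?E = (\<integral>\<^sup>+w'. (\<integral>\<^sup>+w. indicator {s<..} (?R w w') * ?H w w' \<partial>lborel) \<partial>lborel)"
    by (rule lborel_pair.Fubini'[symmetric]) measurable
  also have "\<dots> = (\<integral>\<^sup>+w. (\<integral>\<^sup>+w'. indicator {s<..} (?R w' w) * ?H w w' \<partial>lborel) \<partial>lborel)"
    by (intro nn_integral_cong) (simp add: heis_dist_commute norm_minus_commute)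
  finally have "2 * ?E = ?E + (\<integral>\<^sup>+w. (\<integral>\<^sup>+w'. indicator {s<..} (?R w' w) * ?H w w' \<partial>lborel) \<partial>lborel)"
    by (simp add: mult_2)
  also have "\<dots> = (\<integral>\<^sup>+w. (\<integral>\<^sup>+w'. indicator {s<..} (?R w w') * ?H w w' + indicator {s<..} (?R w' w) * ?H w w' \<partial>lborel) \<partial>lborel)"
    by (subst nn_integral_add[symmetric], measurable, subst nn_integral_add[symmetric], measurable)
  also have "\<dots> \<le> (\<integral>\<^sup>+w. (\<integral>\<^sup>+w'. ?H w w' \<partial>lborel) \<partial>lborel)"
  proof (intro nn_integral_mono)
    fix w w' :: "'n heis"
    have "\<not> (s < ?R w w' \<and> s < ?R w' w)"
    proof
      assume "s < ?R w w' \<and> s < ?R w' w"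
      then have "1 * 1 < ?R w w' * ?R w' w" using s by (intro mult_strict_mono) auto
      then show False by (simp split: if_splits)
    qed
    then show "indicator {s<..} (?R w w') * ?H w w' + indicator {s<..} (?R w' w) * ?H w w' \<le> ?H w w'"
      by (auto simp: indicator_def)
  qed
  finally show ?thesis .
qed

section \<open>The Hardy inequality\<close>

lemma hardy_const_eq:
  fixes \<eta> :: "real ^ ('n::finite + 'n)"
  shows "hardy_const p \<beta> \<eta> = 4 ^ CARD('n) * (ennreal (vertical_const (2 * real CARD('n) + 2 + p * \<beta>)) *
    radial_integral (p * \<beta>) (\<lambda>r. ennreal (\<bar>1 - r powr - ((2 * real CARD('n) - p * \<beta>) / p)\<bar> powr p)) \<eta>)"
proof -
  let ?q = "2 * real CARD('n) + 2 + p * \<beta>"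
  have "?q / 4 - 1 / 2 = (2 * real CARD('n) + p * \<beta>) / 4" by (simp add: field_simps)
  then have const: "4 ^ CARD('n) * sqrt pi * Gamma ((2 * real CARD('n) + p * \<beta>) / 4) / Gamma (?q / 4)
      = 4 ^ CARD('n) * vertical_const ?q"
    by (simp only: vertical_const_def times_divide_eq_right mult.assoc)
  have "hardy_const p \<beta> \<eta> = ennreal (4 ^ CARD('n) * vertical_const ?q) *
    radial_integral (p * \<beta>) (\<lambda>r. ennreal (\<bar>1 - r powr - ((2 * real CARD('n) - p * \<beta>) / p)\<bar> powr p)) \<eta>"
    unfolding hardy_const_def Let_def const radial_integral_def
    by (simp add: ennreal_mult card_UNIV_sum)
  also have "ennreal (4 ^ CARD('n) * vertical_const ?q) = 4 ^ CARD('n) * ennreal (vertical_const ?q)"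
    by (simp add: ennreal_mult' ennreal_power[symmetric])
  finally show ?thesis by (simp add: mult.assoc)
qed

theorem theorem11:
  fixes f :: "'n::finite heis \<Rightarrow> complex"
    and \<beta> p :: real
  assumes "schwartz f"
    and "0 < \<beta>" and "\<beta> < 1"
    and "1 \<le> p" and "p < 2 * real CARD('n) / \<beta>"
  shows "(\<forall>\<eta> \<in> sphere (0 :: real ^ ('n + 'n)) 1.
      (\<integral>\<^sup>+ (w, w'). ennreal (norm (f w - f w') powr p
           / heis_dist w w' powr (2 * real CARD('n) + 2 + p * \<beta>)) \<partial>(heis_haar \<Otimes>\<^sub>M heis_haar))
      \<ge> hardy_const p \<beta> \<eta> *
          (\<integral>\<^sup>+ w. ennreal (norm (fst w) powr (- p * \<beta>) * norm (f w) powr p) \<partial>heis_haar)) \<and>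
    (\<forall>\<eta> \<in> sphere (0 :: real ^ ('n + 'n)) 1. \<forall>\<eta>' \<in> sphere (0 :: real ^ ('n + 'n)) 1.
      hardy_const p \<beta> \<eta> = hardy_const p \<beta> \<eta>')"
proof (intro conjI ballI)
  define \<sigma> where "\<sigma> = p * \<beta>"
  define l where "l = (2 * real CARD('n) - \<sigma>) / p"
  define q where "q = 2 * real CARD('n) + 2 + \<sigma>"
  have \<sigma>: "0 < \<sigma>" "\<sigma> < 2 * real CARD('n)"
    using assms by (auto simp: \<sigma>_def field_simps)
  have l: "0 < l" "l * p = 2 * real CARD('n) - \<sigma>"
    using assms \<sigma> by (auto simp: l_def)
  have f [measurable]: "f \<in> borel_measurable borel"
    by (rule borel_measurable_continuous_onI[OF schwartz_continuous[OF assms(1)]])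
  define M where "M = (\<integral>\<^sup>+w. ennreal (norm (fst w) powr - \<sigma> * norm (f w) powr p) \<partial>lborel)"
  have M: "M < \<infinity>"
    unfolding M_def by (rule schwartz_weighted_integral_finite[OF assms(1,4) \<sigma>])
  let ?H = "\<lambda>w w'. ennreal (norm (f w - f w') powr p * heis_dist w w' powr - q)"
  define E where "E = (\<integral>\<^sup>+w. (\<integral>\<^sup>+w'. ?H w w' \<partial>lborel) \<partial>lborel)"
  fix \<eta> :: "real ^ ('n + 'n)" assume "\<eta> \<in> sphere 0 1"
  then have \<eta>: "norm \<eta> = 1" by simp
  let ?J = "\<lambda>s. radial_integral \<sigma> (\<lambda>r. ennreal (indicator {s<..} r * (1 - r powr - l) powr p)) \<eta>"
  let ?b = "ennreal (vertical_const q)"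
  have "2 * (?b * M * ?J 1) = (SUP n::nat. 2 * (?b * M * ?J (1 + 1 / Suc n)))"
    by (subst radial_integral_exterior_SUP) (simp add: SUP_mult_left_ennreal)
  also have "\<dots> \<le> E"
  proof (rule SUP_least)
    fix n :: nat
    have s: "1 < 1 + 1 / real (Suc n)" by simp
    show "2 * (?b * M * ?J (1 + 1 / Suc n)) \<le> E"
      using heis_energy_exterior_cone[OF f \<eta> assms(4) \<sigma> s] M
      unfolding E_def l_def q_def M_def
      by (intro order_trans[OF mult_left_mono heis_energy_ge_twice_exterior_cone[OF f s]]) auto
  qed
  finally have E: "?b * M * radial_integral \<sigma> (\<lambda>r. ennreal (\<bar>1 - r powr - l\<bar> powr p)) \<eta> \<le> E"
    using radial_integral_eq_twice_exterior[OF \<eta>, of l p \<sigma>] l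
    by (simp add: card_UNIV_sum mult_ac)
  have "(\<integral>\<^sup>+ (w, w'). ennreal (norm (f w - f w') powr p
           / heis_dist w w' powr (2 * real CARD('n) + 2 + p * \<beta>)) \<partial>(heis_haar \<Otimes>\<^sub>M heis_haar))
      = (\<integral>\<^sup>+ (w, w'). ?H w w' \<partial>(heis_haar \<Otimes>\<^sub>M heis_haar))"
    unfolding q_def \<sigma>_def powr_minus_divide by simp
  also have "\<dots> = 4 ^ CARD('n) * (4 ^ CARD('n) * E)"
    unfolding E_def by (rule nn_integral_heis_haar_pair) measurable
  finally have lhs: "(\<integral>\<^sup>+ (w, w'). ennreal (norm (f w - f w') powr p
           / heis_dist w w' powr (2 * real CARD('n) + 2 + p * \<beta>)) \<partial>(heis_haar \<Otimes>\<^sub>M heis_haar))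
      = 4 ^ CARD('n) * (4 ^ CARD('n) * E)" .
  have rhs: "(\<integral>\<^sup>+ w. ennreal (norm (fst w) powr (- p * \<beta>) * norm (f w) powr p) \<partial>heis_haar) = 4 ^ CARD('n) * M"
    unfolding heis_haar_def M_def \<sigma>_def by (subst nn_integral_scale_measure) auto
  have "hardy_const p \<beta> \<eta> * (4 ^ CARD('n) * M) = 4 ^ CARD('n) * (4 ^ CARD('n) *
      (?b * M * radial_integral \<sigma> (\<lambda>r. ennreal (\<bar>1 - r powr - l\<bar> powr p)) \<eta>))"
    by (simp add: hardy_const_eq q_def l_def \<sigma>_def mult_ac)
  also have "\<dots> \<le> 4 ^ CARD('n) * (4 ^ CARD('n) * E)"
    by (intro mult_left_mono E) auto
  finally show "hardy_const p \<beta> \<eta> *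
          (\<integral>\<^sup>+ w. ennreal (norm (fst w) powr (- p * \<beta>) * norm (f w) powr p) \<partial>heis_haar)
    \<le> (\<integral>\<^sup>+ (w, w'). ennreal (norm (f w - f w') powr p
           / heis_dist w w' powr (2 * real CARD('n) + 2 + p * \<beta>)) \<partial>(heis_haar \<Otimes>\<^sub>M heis_haar))"
    unfolding lhs rhs .
next
  fix \<eta> \<eta>' :: "real ^ ('n + 'n)"
  assume "\<eta> \<in> sphere 0 1" "\<eta>' \<in> sphere 0 1"
  then show "hardy_const p \<beta> \<eta> = hardy_const p \<beta> \<eta>'"
    unfolding hardy_const_eq by (subst radial_integral_unit_vector_independent[of \<eta> \<eta>']) auto
qed

end
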